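(* Let $d\ge2$ and $n=\lfloor d/2\rfloor$. For $k\ge2$ let $I_k\subset\mathbb{R}[\lambda_1,\dots,\lambda_d]$ be the ideal generated by $v_2(2\pi),\dots,v_k(2\pi)$, and let the Bautin ideal be $I=\bigcup_{k\ge2}I_k$ (the ideal generated by all $v_k(2\pi)$, $k\ge2$). Then $I=(\lambda_2,\lambda_4,\dots,\lambda_{2n})$, and the Bautin index $B$, defined as the smallest integer $k\ge2$ such that $I_j=I_k$ for all $j\ge k$, equals $2n+1$.
   Context: Let $\lambda=(\lambda_1,\dots,\lambda_d)$ be real parameters, and $p(x)=\sum_{i=1}^d\lambda_i x^i$. Consider the planar Liénard system $\dot x=y$, $\dot y=-x+p(x)y$. In polar coordinates $x=r\cos\theta$, $y=r\sin\theta$ its orbits satisfy $$\frac{dr}{d\theta}=\frac{r\,p(r\cos\theta)\sin^2\theta}{-1+\sin\theta\cos\theta\,p(r\cos\theta)}.$$ For small $r_0$ let $r(\theta;r_0)$ be the solution of this equation with $r(0;r_0)=r_0$. For each $\theta$, the map $r_0\mapsto r(\theta;r_0)$ is analytic near $0$ and tangent to the identity, and its inverse has the expansion $r_0=r+\sum_{k\ge2}v_k(\theta)r^k$ where $r=r(\theta;r_0)$. Each $v_k(\theta)$ is a polynomial in $\lambda$ with real coefficients depending on $\theta$; the $v_k(2\pi)$ are the coefficients of (the inverse of) the first return mapping. *)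

theory Defs
  imports "HOL-Analysis.Analysis"
begin

text \<open>Parameters lambda are modelled as l :: nat => real; only l 1, ..., l d are used.\<close>

definition lp :: "nat \<Rightarrow> (nat \<Rightarrow> real) \<Rightarrow> real \<Rightarrow> real" where
  "lp d l x = (\<Sum>i=1..d. l i * x ^ i)"

definition polarF :: "nat \<Rightarrow> (nat \<Rightarrow> real) \<Rightarrow> real \<Rightarrow> real \<Rightarrow> real" where
  "polarF d l \<theta> r =
     r * lp d l (r * cos \<theta>) * (sin \<theta>)\<^sup>2 / (-1 + sin \<theta> * cos \<theta> * lp d l (r * cos \<theta>))"

definition rsol :: "nat \<Rightarrow> (nat \<Rightarrow> real) \<Rightarrow> real \<Rightarrow> real \<Rightarrow> real" where
  "rsol d l \<theta> r0 = (THE y. \<exists>r. r 0 = r0 \<and>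
      (\<forall>t\<in>{0..\<theta>}. (r has_real_derivative polarF d l t (r t)) (at t within {0..\<theta>})) \<and>
      r \<theta> = y)"

definition inverse_coeff :: "(real \<Rightarrow> real) \<Rightarrow> nat \<Rightarrow> real" where
  "inverse_coeff P k = (THE c. \<exists>\<delta>>0. inj_on P (ball 0 \<delta>) \<and> 0 \<in> interior (P ` ball 0 \<delta>) \<and>
      c = (deriv ^^ k) (inv_into (ball 0 \<delta>) P) 0 / fact k)"

definition vcoeff :: "nat \<Rightarrow> nat \<Rightarrow> real \<Rightarrow> (nat \<Rightarrow> real) \<Rightarrow> real" where
  "vcoeff d k \<theta> l = inverse_coeff (\<lambda>r0. rsol d l \<theta> r0) k"

text \<open>Polynomial functions in lambda_1..lambda_d (over the infinite field R these are
  the same as polynomials of R[lambda_1..lambda_d]).\<close>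
inductive_set polyfun :: "nat \<Rightarrow> ((nat \<Rightarrow> real) \<Rightarrow> real) set" for d where
  const: "(\<lambda>_. c) \<in> polyfun d"
| var: "1 \<le> i \<Longrightarrow> i \<le> d \<Longrightarrow> (\<lambda>l. l i) \<in> polyfun d"
| add: "f \<in> polyfun d \<Longrightarrow> g \<in> polyfun d \<Longrightarrow> (\<lambda>l. f l + g l) \<in> polyfun d"
| mult: "f \<in> polyfun d \<Longrightarrow> g \<in> polyfun d \<Longrightarrow> (\<lambda>l. f l * g l) \<in> polyfun d"

inductive_set gen_ideal :: "nat \<Rightarrow> ((nat \<Rightarrow> real) \<Rightarrow> real) set \<Rightarrow> ((nat \<Rightarrow> real) \<Rightarrow> real) set"
  for d G where
  zero: "(\<lambda>_. 0) \<in> gen_ideal d G"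
| step: "g \<in> polyfun d \<Longrightarrow> h \<in> G \<Longrightarrow> f \<in> gen_ideal d G \<Longrightarrow>
          (\<lambda>l. g l * h l + f l) \<in> gen_ideal d G"

definition Ik :: "nat \<Rightarrow> nat \<Rightarrow> ((nat \<Rightarrow> real) \<Rightarrow> real) set" where
  "Ik d k = gen_ideal d {vcoeff d j (2 * pi) | j. 2 \<le> j \<and> j \<le> k}"

definition bautin_ideal :: "nat \<Rightarrow> ((nat \<Rightarrow> real) \<Rightarrow> real) set" where
  "bautin_ideal d = (\<Union>k\<in>{2..}. Ik d k)"

definition bautin_index :: "nat \<Rightarrow> nat" where
  "bautin_index d = (LEAST k. 2 \<le> k \<and> (\<forall>j\<ge>k. Ik d j = Ik d k))"

end

theory Submission
  imports Defs
begin

text \<open>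
  The inverse map \<open>r\<^sub>0 = H(\<theta>, r)\<close> is a first integral of the polar equation, that is
  \<open>H\<^sub>\<theta> = p(r cos \<theta>) (sin \<theta> cos \<theta> H\<^sub>\<theta> + r sin\<^sup>2 \<theta> H\<^sub>r)\<close> with \<open>H(0, r) = r\<close>. Solving this by
  \<open>H = \<Sum>\<^sub>w a\<^sub>w(\<theta>) \<lambda>\<^sup>w r\<^bsup>1+|w|\<^esup>\<close>, a sum over words \<open>w\<close> in the letters \<open>1,\<dots>,d\<close> of weight \<open>|w|\<close> (the
  sum of the letters), gives a recursion for the \<open>a\<^sub>w\<close> that depends neither on \<open>\<lambda>\<close> nor on \<open>d\<close>. The
  series converges geometrically, so \<open>H\<close> itself yields existence and uniqueness of small solutions
  of the polar equation, and \<open>v\<^sub>k(2\<pi>) = \<Sum>\<^bsub>|w| = k-1\<^esub> a\<^sub>w(2\<pi>) \<lambda>\<^sup>w\<close>. A nonempty word with only odd letters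
  has \<open>a\<^sub>w(2\<pi>) = 0\<close>, by the reversibility \<open>\<theta> \<mapsto> \<pi> - \<theta>\<close>, and the one-letter word \<open>[2j]\<close> has
  \<open>a\<^sub>w(2\<pi>) = \<integral> cos\<^bsup>2j\<^esup> \<theta> sin\<^sup>2 \<theta> d\<theta> > 0\<close>. Hence \<open>v\<^bsub>2j\<^esub>(2\<pi>)\<close> lies in the ideal \<open>(\<lambda>\<^sub>2,\<dots>,\<lambda>\<^bsub>2j-2\<^esub>)\<close>, and modulo that
  ideal \<open>v\<^bsub>2j+1\<^esub>(2\<pi>)\<close> is a nonzero multiple of \<open>\<lambda>\<^bsub>2j\<^esub>\<close>. Below, \<open>a\<^sub>w\<close> is \<open>word_coeff w\<close>, \<open>H\<close> is \<open>fint\<close>, and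
  \<open>fi_coeff m\<close> is the coefficient of \<open>r\<^bsup>m+1\<^esup>\<close> in \<open>H\<close>, that is \<open>v\<^bsub>m+1\<^esub>\<close>.
\<close>

section \<open>Coefficients indexed by words\<close>

text \<open>Chosen by \<open>SOME\<close> rather than as an integral from \<open>0\<close>: the
  derivative is needed on the whole line, since the reflection
  \<open>\<theta> \<mapsto> pi - \<theta>\<close> leads to negative angles.\<close>

definition antideriv :: "(real \<Rightarrow> real) \<Rightarrow> real \<Rightarrow> real" where
  "antideriv f = (SOME F. F 0 = 0 \<and> (\<forall>x. (F has_real_derivative f x) (at x)))"

lemma antideriv:
  assumes "continuous_on UNIV f"
  shows antideriv_0: "antideriv f 0 = 0"
    and antideriv_has_derivative: "(antideriv f has_real_derivative f x) (at x)"
proof -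
  have "\<exists>F. \<forall>x::real. -\<infinity> < ereal x \<longrightarrow> ereal x < \<infinity> \<longrightarrow> (F has_vector_derivative f x) (at x)"
    using assms by (intro einterval_antiderivative) (auto simp: continuous_on_eq_continuous_at)
  then obtain F where F: "\<And>x. (F has_real_derivative f x) (at x)"
    by (auto simp: has_real_derivative_iff_has_vector_derivative)
  have "((\<lambda>x. F x - F 0) has_real_derivative f x) (at x)" for x
    using F by (auto intro!: derivative_eq_intros)
  then have "\<exists>F. F 0 = 0 \<and> (\<forall>x. (F has_real_derivative f x) (at x))"
    by (intro exI[of _ "\<lambda>x. F x - F 0"]) auto
  then have "antideriv f 0 = 0 \<and> (\<forall>x. (antideriv f has_real_derivative f x) (at x))"
    unfolding antideriv_def by (rule someI_ex)
  then show "antideriv f 0 = 0" "(antideriv f has_real_derivative f x) (at x)" by auto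
qed

text \<open>Comparison of coefficients in the equation for \<open>H\<close>: the first letter
  \<open>i\<close> selects the summand \<open>l i * (r * cos \<theta>) ^ i\<close> of
  \<open>p\<close>, and \<open>1 + sum_list w\<close> is the exponent of \<open>r\<close> in the
  term of \<open>w\<close>, brought down by the derivative in \<open>r\<close>.\<close>

primrec word_coeff :: "nat list \<Rightarrow> real \<Rightarrow> real" where
  "word_coeff [] = (\<lambda>\<theta>. 1)"
| "word_coeff (i # w) = antideriv (\<lambda>\<theta>. cos \<theta> ^ i * sin \<theta> *
     (cos \<theta> * deriv (word_coeff w) \<theta> + sin \<theta> * (1 + real (sum_list w)) * word_coeff w \<theta>))"

text \<open>The recursion integrates an expression in the previous derivative, so the induction
  carries continuity of that derivative along.\<close>

lemma word_coeff_C1: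
  "(\<forall>\<theta>. (word_coeff w has_real_derivative deriv (word_coeff w) \<theta>) (at \<theta>)) \<and>
   continuous_on UNIV (deriv (word_coeff w))"
proof (induction w)
  case Nil
  show ?case by (auto intro!: derivative_eq_intros)
next
  case (Cons i w)
  let ?g = "\<lambda>\<theta>. cos \<theta> ^ i * sin \<theta> *
     (cos \<theta> * deriv (word_coeff w) \<theta> + sin \<theta> * (1 + real (sum_list w)) * word_coeff w \<theta>)"
  have "continuous_on UNIV (word_coeff w)"
    using Cons.IH by (auto simp: continuous_on_eq_continuous_at intro: DERIV_isCont)
  then have g: "continuous_on UNIV ?g"
    using Cons.IH by (auto intro!: continuous_intros)
  have D: "(word_coeff (i # w) has_real_derivative ?g \<theta>) (at \<theta>)" for \<theta>
    using antideriv_has_derivative[OF g] by simp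
  then have "deriv (word_coeff (i # w)) = ?g" by (auto intro!: DERIV_imp_deriv)
  then show ?case using D g by (simp del: word_coeff.simps)
qed

lemma word_coeff_has_derivative: "(word_coeff w has_real_derivative deriv (word_coeff w) \<theta>) (at \<theta>)"
  using word_coeff_C1 by blast

lemma continuous_deriv_word_coeff: "continuous_on UNIV (deriv (word_coeff w))"
  using word_coeff_C1 by blast

lemma word_coeff_Cons:
  shows word_coeff_Cons_0: "word_coeff (i # w) 0 = 0"
    and deriv_word_coeff_Cons: "deriv (word_coeff (i # w)) \<theta> = cos \<theta> ^ i * sin \<theta> *
     (cos \<theta> * deriv (word_coeff w) \<theta> + sin \<theta> * (1 + real (sum_list w)) * word_coeff w \<theta>)"
proof -
  let ?g = "\<lambda>\<theta>. cos \<theta> ^ i * sin \<theta> *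
     (cos \<theta> * deriv (word_coeff w) \<theta> + sin \<theta> * (1 + real (sum_list w)) * word_coeff w \<theta>)"
  have "continuous_on UNIV (word_coeff w)"
    using word_coeff_has_derivative by (auto simp: continuous_on_eq_continuous_at intro: DERIV_isCont)
  then have g: "continuous_on UNIV ?g"
    using continuous_deriv_word_coeff by (auto intro!: continuous_intros)
  show "word_coeff (i # w) 0 = 0" using antideriv_0[OF g] by simp
  show "deriv (word_coeff (i # w)) \<theta> = ?g \<theta>"
    using antideriv_has_derivative[OF g, of \<theta>] by (auto intro!: DERIV_imp_deriv)
qed

text \<open>Under \<open>\<theta> \<mapsto> pi - \<theta>\<close> the bracket of the recursion is
  invariant while \<open>cos \<theta> ^ i\<close> changes sign for odd \<open>i\<close>, so the
  derivative is antisymmetric and the coefficient symmetric. Periodicity of the coefficient does not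
  follow from that of its derivative alone; the symmetry supplies it.\<close>

lemma word_coeff_odd:
  assumes "\<forall>i\<in>set w. odd i"
  shows "(\<forall>\<theta>. word_coeff w (pi - \<theta>) = word_coeff w \<theta>) \<and>
         (\<forall>\<theta>. deriv (word_coeff w) (pi - \<theta>) = - deriv (word_coeff w) \<theta>) \<and>
         (\<forall>\<theta>. word_coeff w (\<theta> + 2 * pi) = word_coeff w \<theta>) \<and>
         (\<forall>\<theta>. deriv (word_coeff w) (\<theta> + 2 * pi) = deriv (word_coeff w) \<theta>)"
  using assms
proof (induction w)
  case Nil
  then show ?case by simp
next
  case (Cons i w)
  let ?f = "word_coeff (i # w)"
  have i: "odd i" using Cons.prems by simp
  have d1: "deriv ?f (pi - \<theta>) = - deriv ?f \<theta>" for \<theta>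
    using Cons i by (simp add: deriv_word_coeff_Cons cos_diff sin_diff algebra_simps del: word_coeff.simps)
  have d2: "deriv ?f (\<theta> + 2 * pi) = deriv ?f \<theta>" for \<theta>
    using Cons by (simp add: deriv_word_coeff_Cons del: word_coeff.simps)
  have "((\<lambda>\<theta>. ?f (pi - \<theta>) - ?f \<theta>) has_real_derivative 0) (at \<theta>)" for \<theta>
    using d1 by (auto intro!: derivative_eq_intros DERIV_chain2[OF word_coeff_has_derivative] word_coeff_has_derivative
      simp del: word_coeff.simps)
  \<comment> \<open>The reflection fixes \<open>pi/2\<close>, so the constant is
    \<open>0\<close>.\<close>
  then have "?f (pi - \<theta>) - ?f \<theta> = ?f (pi - pi/2) - ?f (pi/2)" for \<theta>
    using DERIV_isconst_all by blast
  then have s1: "?f (pi - \<theta>) = ?f \<theta>" for \<theta> by (simp del: word_coeff.simps)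
  have "((\<lambda>\<theta>. ?f (\<theta> + 2 * pi) - ?f \<theta>) has_real_derivative 0) (at \<theta>)" for \<theta>
    using d2 by (auto intro!: derivative_eq_intros DERIV_chain2[OF word_coeff_has_derivative] word_coeff_has_derivative
      simp del: word_coeff.simps)
  then have "?f (\<theta> + 2 * pi) - ?f \<theta> = ?f (- pi/2 + 2 * pi) - ?f (- pi/2)" for \<theta>
    using DERIV_isconst_all by blast
  \<comment> \<open>The points \<open>- pi/2\<close> and \<open>3 * pi/2\<close> differ by a full
    turn and are exchanged by the reflection.\<close>
  moreover have "?f (- pi/2 + 2 * pi) = ?f (- pi/2)"
    using s1[of "- pi/2"] by (simp del: word_coeff.simps add: field_simps)
  ultimately have "?f (\<theta> + 2 * pi) = ?f \<theta>" for \<theta> by (simp del: word_coeff.simps)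
  then show ?case using s1 d1 d2 by blast
qed

lemma word_coeff_odd_full_turn:
  assumes "\<forall>i\<in>set w. odd i" "w \<noteq> []"
  shows "word_coeff w (2 * pi) = 0"
proof -
  obtain i v where w: "w = i # v" using assms(2) by (cases w) auto
  have "word_coeff w (0 + 2 * pi) = word_coeff w 0" using word_coeff_odd[OF assms(1)] by blast
  then show ?thesis by (simp add: w word_coeff_Cons_0 del: word_coeff.simps)
qed

text \<open>The derivative \<open>cos \<theta> ^ i * sin \<theta> ^ 2\<close> is nonnegative for
  even \<open>i\<close> and strictly positive on \<open>{pi/4..pi/3}\<close>, a convenient interval
  inside the first quadrant.\<close>

lemma word_coeff_even_letter_full_turn:
  assumes "even i"
  shows "word_coeff [i] (2 * pi) > 0"
proof -
  let ?f = "word_coeff [i]"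
  have d: "deriv ?f \<theta> = cos \<theta> ^ i * (sin \<theta>)\<^sup>2" for \<theta>
    unfolding deriv_word_coeff_Cons by (simp add: power2_eq_square)
  have mono: "?f x \<le> ?f y" if "x \<le> y" for x y
    using that by (rule DERIV_nonneg_imp_nondecreasing)
      (metis assms d mult_nonneg_nonneg word_coeff_has_derivative zero_le_even_power zero_le_power2)
  have "?f (pi/4) < ?f (pi/3)"
  proof (rule DERIV_pos_imp_increasing[where f = ?f])
    fix x assume x: "pi/4 \<le> x" "x \<le> pi/3"
    then have "0 < x" "x < pi / 2" using pi_gt_zero by linarith+
    then have "sin x > 0" "cos x > 0" by (auto intro!: sin_gt_zero cos_gt_zero)
    then show "\<exists>y. (?f has_real_derivative y) (at x) \<and> 0 < y"
      using word_coeff_has_derivative[of "[i]" x] unfolding d by auto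
  qed simp
  moreover have "?f 0 \<le> ?f (pi/4)" "?f (pi/3) \<le> ?f (2*pi)" by (rule mono; simp)+
  ultimately show ?thesis using word_coeff_Cons_0[of i "[]"] by linarith
qed

section \<open>Words of given weight and the coefficients of powers of \<open>r\<close>\<close>

definition words :: "nat \<Rightarrow> nat \<Rightarrow> nat list set" where
  "words d m = {w. set w \<subseteq> {1..d} \<and> sum_list w = m}"

lemma finite_words: "finite (words d m)"
proof (rule finite_subset)
  have "length w \<le> sum_list w" if "set w \<subseteq> {1..d}" for w
    using that by (induction w) auto
  then show "words d m \<subseteq> {w. set w \<subseteq> {1..d} \<and> length w \<le> m}"
    by (auto simp: words_def)
qed (simp add: finite_lists_length_le)

lemma words_0: "words d 0 = {[]}"
proof -
  have "w = []" if "set w \<subseteq> {1..d}" "sum_list w = 0" for w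
    using that by (cases w) auto
  then show ?thesis by (auto simp: words_def)
qed

text \<open>Splits off the first letter, which exists because \<open>m > 0\<close>. The guard
  \<open>i \<le> m\<close> keeps the outer range independent of \<open>m\<close>, so that the sum
  over letters can be exchanged with a series in \<open>m\<close>.\<close>

lemma sum_words_Cons:
  fixes f :: "nat list \<Rightarrow> real"
  assumes "m > 0"
  shows "(\<Sum>w\<in>words d m. f w) = (\<Sum>i=1..d. if i \<le> m then \<Sum>w\<in>words d (m - i). f (i # w) else 0)"
proof -
  have "(\<Sum>i=1..d. if i \<le> m then \<Sum>w\<in>words d (m - i). f (i # w) else 0)
      = (\<Sum>i\<in>{i\<in>{1..d}. i \<le> m}. \<Sum>w\<in>words d (m - i). f (i # w))"
    by (rule sum.inter_filter[symmetric]) simp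
  also have "\<dots> = (\<Sum>(i,w)\<in>(SIGMA i:{i\<in>{1..d}. i \<le> m}. words d (m - i)). f (i # w))"
    by (rule sum.Sigma) (auto simp: finite_words)
  also have "\<dots> = (\<Sum>w\<in>words d m. f w)"
  proof (rule sum.reindex_bij_witness[of _ "\<lambda>w. (hd w, tl w)" "\<lambda>(i, w). i # w"])
    fix w assume w: "w \<in> words d m"
    then obtain i v where "w = i # v" using assms by (cases w) (auto simp: words_def)
    then show "(case (hd w, tl w) of (i, w) \<Rightarrow> i # w) = w"
      "(hd w, tl w) \<in> (SIGMA i:{i\<in>{1..d}. i \<le> m}. words d (m - i))"
      using w by (auto simp: words_def)
  qed (auto simp: words_def)
  finally show ?thesis by simp
qed

definition fi_coeff :: "nat \<Rightarrow> (nat \<Rightarrow> real) \<Rightarrow> nat \<Rightarrow> real \<Rightarrow> real" where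
  "fi_coeff d l m \<theta> = (\<Sum>w\<in>words d m. word_coeff w \<theta> * prod_list (map l w))"

definition fi_coeff' :: "nat \<Rightarrow> (nat \<Rightarrow> real) \<Rightarrow> nat \<Rightarrow> real \<Rightarrow> real" where
  "fi_coeff' d l m \<theta> = (\<Sum>w\<in>words d m. deriv (word_coeff w) \<theta> * prod_list (map l w))"

lemma fi_coeff_has_derivative: "(fi_coeff d l m has_real_derivative fi_coeff' d l m \<theta>) (at \<theta>)"
  unfolding fi_coeff_def[abs_def] fi_coeff'_def
  by (auto intro!: derivative_eq_intros word_coeff_has_derivative)

lemma fi_coeff_0: "fi_coeff d l 0 \<theta> = 1" and fi_coeff'_0: "fi_coeff' d l 0 \<theta> = 0"
  by (simp_all add: fi_coeff_def fi_coeff'_def words_0)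

lemma fi_coeff_at_0: "m > 0 \<Longrightarrow> fi_coeff d l m 0 = 0"
  unfolding fi_coeff_def by (subst sum_words_Cons) (auto simp: word_coeff_Cons_0 simp del: word_coeff.simps intro!: sum.neutral)

text \<open>The coefficient of \<open>r ^ (m + 1)\<close> in the equation for \<open>H\<close>: the
  summand \<open>i\<close> of \<open>p\<close> raises the degree by \<open>i\<close>.\<close>

lemma fi_coeff'_recurrence:
  assumes "m > 0"
  shows "fi_coeff' d l m \<theta> = (\<Sum>i=1..d. if i \<le> m then l i * cos \<theta> ^ i * sin \<theta> *
     (cos \<theta> * fi_coeff' d l (m - i) \<theta> + sin \<theta> * real (m - i + 1) * fi_coeff d l (m - i) \<theta>) else 0)"
proof -
  have "(\<Sum>w\<in>words d k. deriv (word_coeff (i # w)) \<theta> * prod_list (map l (i # w)))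
     = l i * cos \<theta> ^ i * sin \<theta> * (cos \<theta> * fi_coeff' d l k \<theta> + sin \<theta> * real (k + 1) * fi_coeff d l k \<theta>)" for i k
    unfolding fi_coeff'_def fi_coeff_def sum_distrib_left sum.distrib[symmetric]
    by (rule sum.cong) (auto simp: deriv_word_coeff_Cons words_def algebra_simps simp del: word_coeff.simps)
  then show ?thesis
    unfolding fi_coeff'_def[of _ _ m] by (subst sum_words_Cons[OF assms]) (auto intro!: sum.cong)
qed

section \<open>Geometric bounds for the coefficients\<close>

definition growth :: "nat \<Rightarrow> (nat \<Rightarrow> real) \<Rightarrow> real \<Rightarrow> real" where
  "growth d l \<theta> = (2 * (\<Sum>i=1..d. \<bar>l i\<bar>) + 1) * exp \<theta>"

text \<open>Strong induction on \<open>m\<close>. With \<open>A\<close> the sum of the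
  \<open>\<bar>l i\<bar>\<close> and \<open>G\<close> the growth function, the recurrence bounds the
  derivative by \<open>2 * A * m * G ^ (m - 1)\<close>, which is at most \<open>m * G ^ m\<close>
  since \<open>G \<ge> 2 * A\<close>; the summand \<open>1\<close> in \<open>growth\<close> gives
  \<open>G \<ge> 1\<close>, so lower powers are dominated. As \<open>G' = G\<close>, this is the
  derivative of \<open>G ^ m\<close>, and comparison from angle \<open>0\<close> bounds the
  coefficient.\<close>

lemma fi_coeff_bounds:
  assumes "\<theta> \<ge> 0"
  shows "\<bar>fi_coeff d l m \<theta>\<bar> \<le> growth d l \<theta> ^ m \<and> \<bar>fi_coeff' d l m \<theta>\<bar> \<le> real m * growth d l \<theta> ^ m"
  using assms
proof (induction m arbitrary: \<theta> rule: less_induct)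
  case (less m)
  define A where "A = (\<Sum>i=1..d. \<bar>l i\<bar>)"
  have A0: "A \<ge> 0" by (simp add: A_def sum_nonneg)
  show ?case
  proof (cases "m = 0")
    case True
    then show ?thesis by (simp add: fi_coeff_0 fi_coeff'_0)
  next
    case False
    then have m: "m > 0" by simp
    have d: "\<bar>fi_coeff' d l m t\<bar> \<le> real m * growth d l t ^ m" if t: "t \<ge> 0" for t
    proof -
      let ?E = "growth d l t"
      have E: "?E \<ge> 2 * A + 1"
      proof -
        have "(2 * A + 1) * 1 \<le> (2 * A + 1) * exp t" using A0 t by (intro mult_left_mono) auto
        then show ?thesis by (simp add: growth_def A_def)
      qed
      then have E1: "?E \<ge> 1" using A0 by linarith
      have letter: "\<bar>l i * cos t ^ i * sin t *
           (cos t * fi_coeff' d l (m - i) t + sin t * real (m - i + 1) * fi_coeff d l (m - i) t)\<bar>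
          \<le> \<bar>l i\<bar> * (2 * real m * ?E ^ (m - 1))" if i: "1 \<le> i" "i \<le> m" for i
      proof -
        have b: "\<bar>fi_coeff d l (m - i) t\<bar> \<le> ?E ^ (m - i)" "\<bar>fi_coeff' d l (m - i) t\<bar> \<le> real (m - i) * ?E ^ (m - i)"
          using less.IH[of "m - i" t] i t by auto
        have "\<bar>cos t * fi_coeff' d l (m - i) t\<bar> \<le> 1 * (real (m - i) * ?E ^ (m - i))"
          unfolding abs_mult by (intro mult_mono b) auto
        moreover have "\<bar>sin t * real (m - i + 1) * fi_coeff d l (m - i) t\<bar> \<le> 1 * real (m - i + 1) * ?E ^ (m - i)"
          unfolding abs_mult by (intro mult_mono b) auto
        ultimately have "\<bar>cos t * fi_coeff' d l (m - i) t + sin t * real (m - i + 1) * fi_coeff d l (m - i) t\<bar>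
            \<le> (real (m - i) + real (m - i + 1)) * ?E ^ (m - i)"
          unfolding distrib_right by linarith
        also have "\<dots> \<le> (2 * real m) * ?E ^ (m - 1)"
          using i E1 by (intro mult_mono power_increasing) (auto simp: of_nat_diff)
        finally have 1: "\<bar>cos t * fi_coeff' d l (m - i) t + sin t * real (m - i + 1) * fi_coeff d l (m - i) t\<bar>
            \<le> 2 * real m * ?E ^ (m - 1)" .
        have "\<bar>cos t ^ i * sin t\<bar> \<le> 1 * 1"
          unfolding abs_mult power_abs by (intro mult_mono power_le_one) auto
        then have "\<bar>cos t ^ i * sin t\<bar> * \<bar>cos t * fi_coeff' d l (m - i) t + sin t * real (m - i + 1) * fi_coeff d l (m - i) t\<bar>
            \<le> 1 * (2 * real m * ?E ^ (m - 1))"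
          by (intro mult_mono 1) auto
        then have "\<bar>l i\<bar> * (\<bar>cos t ^ i * sin t\<bar> * \<bar>cos t * fi_coeff' d l (m - i) t + sin t * real (m - i + 1) * fi_coeff d l (m - i) t\<bar>)
            \<le> \<bar>l i\<bar> * (2 * real m * ?E ^ (m - 1))"
          by (intro mult_left_mono) auto
        then show ?thesis by (simp add: abs_mult mult.assoc)
      qed
      have "\<bar>fi_coeff' d l m t\<bar> \<le> (\<Sum>i=1..d. \<bar>l i\<bar> * (2 * real m * ?E ^ (m - 1)))"
        unfolding fi_coeff'_recurrence[OF m]
        by (rule order.trans[OF sum_abs], rule sum_mono) (use letter E1 in auto)
      also have "\<dots> = real m * (2 * A * ?E ^ (m - 1))"
        by (simp add: sum_distrib_right[symmetric] A_def)
      also have "\<dots> \<le> real m * (?E * ?E ^ (m - 1))"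
        using E E1 by (intro mult_left_mono mult_right_mono) auto
      also have "?E * ?E ^ (m - 1) = ?E ^ m" using m by (simp add: power_eq_if)
      finally show ?thesis .
    qed
    have G: "((\<lambda>t. growth d l t ^ m) has_real_derivative real m * growth d l t ^ m) (at t)" for t
    proof -
      obtain k where k: "m = Suc k" using m gr0_implies_Suc by blast
      have "(growth d l has_real_derivative growth d l t) (at t)"
        unfolding growth_def[abs_def] by (auto intro!: derivative_eq_intros)
      then show ?thesis
        unfolding k by (rule DERIV_cong[OF DERIV_power]) simp
    qed
    have g0: "growth d l 0 ^ m \<ge> 0" using A0 by (simp add: growth_def A_def)
    have "growth d l 0 ^ m - fi_coeff d l m 0 \<le> growth d l \<theta> ^ m - fi_coeff d l m \<theta>"
    proof (rule DERIV_nonneg_imp_nondecreasing[OF less.prems, of "\<lambda>t. growth d l t ^ m - fi_coeff d l m t"])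
      fix t assume "0 \<le> t" "t \<le> \<theta>"
      then have "0 \<le> real m * growth d l t ^ m - fi_coeff' d l m t" using d[of t] by linarith
      moreover have "((\<lambda>t. growth d l t ^ m - fi_coeff d l m t) has_real_derivative
          real m * growth d l t ^ m - fi_coeff' d l m t) (at t)"
        by (intro derivative_intros G fi_coeff_has_derivative)
      ultimately show "\<exists>y. ((\<lambda>t. growth d l t ^ m - fi_coeff d l m t) has_real_derivative y) (at t) \<and> 0 \<le> y"
        by blast
    qed
    moreover have "growth d l 0 ^ m + fi_coeff d l m 0 \<le> growth d l \<theta> ^ m + fi_coeff d l m \<theta>"
    proof (rule DERIV_nonneg_imp_nondecreasing[OF less.prems, of "\<lambda>t. growth d l t ^ m + fi_coeff d l m t"])
      fix t assume "0 \<le> t" "t \<le> \<theta>"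
      then have "0 \<le> real m * growth d l t ^ m + fi_coeff' d l m t" using d[of t] by linarith
      moreover have "((\<lambda>t. growth d l t ^ m + fi_coeff d l m t) has_real_derivative
          real m * growth d l t ^ m + fi_coeff' d l m t) (at t)"
        by (intro derivative_intros G fi_coeff_has_derivative)
      ultimately show "\<exists>y. ((\<lambda>t. growth d l t ^ m + fi_coeff d l m t) has_real_derivative y) (at t) \<and> 0 \<le> y"
        by blast
    qed
    ultimately show ?thesis using d[OF less.prems] g0 fi_coeff_at_0[OF m, of d l] by auto
  qed
qed

section \<open>The first integral\<close>

text \<open>The value of \<open>1 / (1 - q) ^ 2\<close> at \<open>q = 1/4\<close>. Without the
  leading \<open>1\<close> the sum is \<open>7/9 < 1\<close>, which will separate the divided
  difference of \<open>H\<close> from \<open>0\<close>.\<close>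

lemma linear_geometric_sums: "(\<lambda>m. real (Suc m) * (1/4) ^ m) sums (16/9)"
  using geometric_deriv_sums[of "1/4 :: real"] by (simp add: power2_eq_square)

context
  fixes d :: nat and l :: "nat \<Rightarrow> real"
begin

text \<open>The factor \<open>4\<close> gives \<open>radius * growth = 1/4\<close> at
  \<open>2 * pi\<close>, where \<open>growth\<close> is largest on \<open>{0..2*pi}\<close>. The
  three series below are thus dominated uniformly in \<open>\<theta>\<close> by multiples of
  \<open>(1/4) ^ m\<close> or \<open>(m + 1) * (1/4) ^ m\<close>.\<close>

definition radius :: real where
  "radius = 1 / (4 * growth d l (2 * pi))"

definition fint :: "real \<Rightarrow> real \<Rightarrow> real" where
  "fint \<theta> r = (\<Sum>m. fi_coeff d l m \<theta> * r ^ Suc m)"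

definition fint_d\<theta> :: "real \<Rightarrow> real \<Rightarrow> real" where
  "fint_d\<theta> \<theta> r = (\<Sum>m. fi_coeff' d l m \<theta> * r ^ Suc m)"

text \<open>The divided difference of \<open>H\<close> in \<open>r\<close>, jointly continuous and bounded away from \<open>0\<close>: it replaces
  total differentiability of \<open>H\<close> in the chain rule and the implicit function theorem.\<close>
definition fint_slope :: "real \<Rightarrow> real \<Rightarrow> real \<Rightarrow> real" where
  "fint_slope \<theta> a b = (\<Sum>m. fi_coeff d l m \<theta> * (\<Sum>j<Suc m. a ^ j * b ^ (m - j)))"

lemma growth_mono: "\<theta> \<le> t \<Longrightarrow> growth d l \<theta> \<le> growth d l t"
  unfolding growth_def by (intro mult_left_mono) (auto intro!: add_nonneg_nonneg sum_nonneg)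

lemma growth_ge: "\<theta> \<ge> 0 \<Longrightarrow> growth d l \<theta> \<ge> 2 * (\<Sum>i=1..d. \<bar>l i\<bar>) + 1"
  using growth_mono[of 0 \<theta>] by (simp add: growth_def)

lemma growth_pos: "growth d l \<theta> > 0"
  unfolding growth_def by (intro mult_pos_pos add_nonneg_pos) (auto intro!: sum_nonneg)

lemma radius_pos: "radius > 0"
  using growth_pos by (simp add: radius_def)

lemma radius_growth: "radius * growth d l (2 * pi) = 1/4"
  using growth_pos[of "2 * pi"] by (simp add: radius_def field_simps)

text \<open>Keeps the denominator of \<open>polarF\<close> away from \<open>0\<close>. As
  \<open>radius \<le> 1/4\<close>, all powers of \<open>x\<close> are at most
  \<open>\<bar>x\<bar>\<close>.\<close>

lemma lp_bound:
  assumes "\<bar>x\<bar> \<le> radius"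
  shows "\<bar>lp d l x\<bar> \<le> 1/4"
proof -
  let ?A = "\<Sum>i=1..d. \<bar>l i\<bar>"
  have A: "0 \<le> ?A" by (simp add: sum_nonneg)
  have ge: "growth d l (2 * pi) \<ge> 2 * ?A + 1" by (rule growth_ge) simp
  then have "radius * (2 * ?A + 1) \<le> 1/4"
    using mult_left_mono[OF ge, of radius] radius_pos radius_growth by simp
  moreover have "0 \<le> radius * ?A" using A radius_pos by auto
  moreover have "radius * (2 * ?A + 1) = 2 * (radius * ?A) + radius" by (simp add: algebra_simps)
  ultimately have r: "radius \<le> 1/4" "radius * ?A \<le> 1/4" using radius_pos by linarith+
  have "\<bar>lp d l x\<bar> \<le> (\<Sum>i=1..d. \<bar>l i\<bar> * radius)"
    unfolding lp_def
  proof (rule order.trans[OF sum_abs], rule sum_mono)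
    fix i assume i: "i \<in> {1..d}"
    have "\<bar>x\<bar> ^ i \<le> \<bar>x\<bar> ^ 1"
      using i assms r(1) by (intro power_decreasing) auto
    then show "\<bar>l i * x ^ i\<bar> \<le> \<bar>l i\<bar> * radius"
      using assms by (auto simp: abs_mult power_abs intro!: mult_left_mono)
  qed
  also have "\<dots> = radius * ?A" by (simp add: sum_distrib_right[symmetric])
  finally show ?thesis using r(2) by simp
qed

lemma growth_power_bound:
  assumes "\<theta> \<in> {0..2*pi}" "c \<ge> 0" "\<bar>u\<bar> \<le> c * growth d l \<theta> ^ m" "\<bar>v\<bar> \<le> b * radius ^ m"
  shows "\<bar>u * v\<bar> \<le> c * b * (1/4) ^ m"
proof -
  have "growth d l \<theta> ^ m \<le> growth d l (2 * pi) ^ m"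
    using assms(1) growth_pos[of \<theta>] by (intro power_mono growth_mono) auto
  then have "\<bar>u\<bar> \<le> c * growth d l (2 * pi) ^ m"
    using assms(2,3) by (meson mult_left_mono order.trans)
  then have "\<bar>u * v\<bar> \<le> (c * growth d l (2 * pi) ^ m) * (b * radius ^ m)"
    unfolding abs_mult using assms(2,4) growth_pos[of "2 * pi"] by (intro mult_mono) auto
  also have "\<dots> = c * b * (1/4) ^ m"
    unfolding radius_growth[symmetric] power_mult_distrib by simp
  finally show ?thesis .
qed

lemma fint_term_bound:
  assumes "\<theta> \<in> {0..2*pi}" "\<bar>r\<bar> \<le> radius"
  shows "\<bar>fi_coeff d l m \<theta> * r ^ Suc m\<bar> \<le> radius * (1/4) ^ m"
proof -
  have "\<bar>r ^ Suc m\<bar> \<le> radius ^ Suc m"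
    unfolding power_abs using assms(2) by (intro power_mono) auto
  then show ?thesis
    using growth_power_bound[OF assms(1), of 1 "fi_coeff d l m \<theta>" m "r ^ Suc m" radius] fi_coeff_bounds[of \<theta> d l m] assms(1)
    by simp
qed

lemma fint_d\<theta>_term_bound:
  assumes "\<theta> \<in> {0..2*pi}" "\<bar>r\<bar> \<le> radius"
  shows "\<bar>fi_coeff' d l m \<theta> * r ^ Suc m\<bar> \<le> radius * (real (Suc m) * (1/4) ^ m)"
proof -
  have "\<bar>r ^ Suc m\<bar> \<le> radius ^ Suc m"
    unfolding power_abs using assms(2) by (intro power_mono) auto
  then have "\<bar>fi_coeff' d l m \<theta> * r ^ Suc m\<bar> \<le> real m * radius * (1/4) ^ m"
    using growth_power_bound[OF assms(1), of "real m" "fi_coeff' d l m \<theta>" m "r ^ Suc m" radius] fi_coeff_bounds[of \<theta> d l m] assms(1)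
    by simp
  also have "\<dots> \<le> real (Suc m) * radius * (1/4) ^ m"
    using radius_pos by (intro mult_right_mono) auto
  finally show ?thesis by (simp add: algebra_simps)
qed

lemma fint_slope_term_bound:
  assumes "\<theta> \<in> {0..2*pi}" "\<bar>a\<bar> \<le> radius" "\<bar>b\<bar> \<le> radius"
  shows "\<bar>fi_coeff d l m \<theta> * (\<Sum>j<Suc m. a ^ j * b ^ (m - j))\<bar> \<le> real (Suc m) * (1/4) ^ m"
proof -
  have "\<bar>\<Sum>j<Suc m. a ^ j * b ^ (m - j)\<bar> \<le> (\<Sum>j<Suc m. radius ^ m)"
  proof (rule order.trans[OF sum_abs], rule sum_mono)
    fix j assume j: "j \<in> {..<Suc m}"
    have "\<bar>a ^ j * b ^ (m - j)\<bar> \<le> radius ^ j * radius ^ (m - j)"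
      unfolding abs_mult power_abs using assms by (intro mult_mono power_mono) auto
    also have "\<dots> = radius ^ m" using j by (simp add: power_add[symmetric])
    finally show "\<bar>a ^ j * b ^ (m - j)\<bar> \<le> radius ^ m" .
  qed
  then have "\<bar>\<Sum>j<Suc m. a ^ j * b ^ (m - j)\<bar> \<le> real (Suc m) * radius ^ m"
    by (simp del: sum.lessThan_Suc)
  then show ?thesis
    using growth_power_bound[OF assms(1), of 1 "fi_coeff d l m \<theta>" m "\<Sum>j<Suc m. a ^ j * b ^ (m - j)" "real (Suc m)"]
      fi_coeff_bounds[of \<theta> d l m] assms(1)
    by (simp del: sum.lessThan_Suc)
qed

section \<open>Convergence and regularity of the first integral\<close>

lemma summable_bound: "summable (\<lambda>m. c * (1/4) ^ m :: real)" "summable (\<lambda>m. c * (real (Suc m) * (1/4) ^ m))"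
  using linear_geometric_sums by (auto intro!: summable_mult simp: sums_iff)

lemma fint_sums:
  assumes "\<theta> \<in> {0..2*pi}" "\<bar>r\<bar> \<le> radius"
  shows "(\<lambda>m. fi_coeff d l m \<theta> * r ^ Suc m) sums fint \<theta> r"
  unfolding fint_def using fint_term_bound[OF assms]
  by (intro summable_sums summable_comparison_test'[OF summable_bound(1)[of radius], of 0]) simp

lemma fint_d\<theta>_sums:
  assumes "\<theta> \<in> {0..2*pi}" "\<bar>r\<bar> \<le> radius"
  shows "(\<lambda>m. fi_coeff' d l m \<theta> * r ^ Suc m) sums fint_d\<theta> \<theta> r"
  unfolding fint_d\<theta>_def
proof (intro summable_sums summable_comparison_test'[OF summable_bound(2)[of radius], of 0])
  fix m show "norm (fi_coeff' d l m \<theta> * r ^ Suc m) \<le> radius * (real (Suc m) * (1/4) ^ m)"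
    using fint_d\<theta>_term_bound[OF assms, of m] unfolding real_norm_def .
qed

lemma fint_slope_sums:
  assumes "\<theta> \<in> {0..2*pi}" "\<bar>a\<bar> \<le> radius" "\<bar>b\<bar> \<le> radius"
  shows "(\<lambda>m. fi_coeff d l m \<theta> * (\<Sum>j<Suc m. a ^ j * b ^ (m - j))) sums fint_slope \<theta> a b"
  unfolding fint_slope_def
proof (intro summable_sums summable_comparison_test'[OF summable_bound(2)[of 1], of 0])
  fix m show "norm (fi_coeff d l m \<theta> * (\<Sum>j<Suc m. a ^ j * b ^ (m - j))) \<le> 1 * (real (Suc m) * (1/4) ^ m)"
    using fint_slope_term_bound[OF assms, of m] unfolding real_norm_def mult_1 .
qed

lemma fint_diff:
  assumes "\<theta> \<in> {0..2*pi}" "\<bar>a\<bar> \<le> radius" "\<bar>b\<bar> \<le> radius"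
  shows "fint \<theta> a - fint \<theta> b = fint_slope \<theta> a b * (a - b)"
proof -
  have eq: "fi_coeff d l m \<theta> * a ^ Suc m - fi_coeff d l m \<theta> * b ^ Suc m
      = fi_coeff d l m \<theta> * (\<Sum>j<Suc m. a ^ j * b ^ (m - j)) * (a - b)" for m
    unfolding right_diff_distrib[symmetric] diff_power_eq_sum by (simp only: ac_simps)
  have "(\<lambda>m. fi_coeff d l m \<theta> * a ^ Suc m - fi_coeff d l m \<theta> * b ^ Suc m) sums (fint \<theta> a - fint \<theta> b)"
    by (intro sums_diff fint_sums assms)
  moreover have "(\<lambda>m. fi_coeff d l m \<theta> * a ^ Suc m - fi_coeff d l m \<theta> * b ^ Suc m) sums (fint_slope \<theta> a b * (a - b))"
    unfolding eq by (intro sums_mult2 fint_slope_sums assms)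
  ultimately show ?thesis by (rule sums_unique2)
qed

text \<open>The term \<open>m = 0\<close> is \<open>1\<close>, and the others add up to at most
  \<open>16/9 - 1 = 7/9\<close> in modulus.\<close>

lemma fint_slope_bounds:
  assumes "\<theta> \<in> {0..2*pi}" "\<bar>a\<bar> \<le> radius" "\<bar>b\<bar> \<le> radius"
  shows "2/9 \<le> fint_slope \<theta> a b" "fint_slope \<theta> a b \<le> 16/9"
proof -
  let ?f = "\<lambda>m. fi_coeff d l m \<theta> * (\<Sum>j<Suc m. a ^ j * b ^ (m - j))"
  let ?g = "\<lambda>m. real (Suc m) * (1/4) ^ m"
  have f: "(\<lambda>m. ?f (Suc m)) sums (fint_slope \<theta> a b - ?f 0)"
    using fint_slope_sums[OF assms] by (subst sums_Suc_iff) simp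
  have g: "(\<lambda>m. ?g (Suc m)) sums (16/9 - ?g 0)"
    using linear_geometric_sums by (subst sums_Suc_iff) simp
  have "norm (\<Sum>m. ?f (Suc m)) \<le> (\<Sum>m. ?g (Suc m))"
  proof (rule norm_suminf_le)
    show "norm (?f (Suc m)) \<le> ?g (Suc m)" for m
      unfolding real_norm_def by (rule fint_slope_term_bound[OF assms])
    show "summable (\<lambda>m. ?g (Suc m))" using g by (rule sums_summable)
  qed
  then have "\<bar>fint_slope \<theta> a b - 1\<bar> \<le> 7/9"
    unfolding sums_unique[OF f, symmetric] sums_unique[OF g, symmetric] by (simp add: fi_coeff_0)
  then show "2/9 \<le> fint_slope \<theta> a b" "fint_slope \<theta> a b \<le> 16/9" by linarith+
qed

lemma fint_has_derivative:
  assumes "\<theta> \<in> {0..2*pi}" "\<bar>r\<bar> \<le> radius"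
  shows "((\<lambda>\<theta>. fint \<theta> r) has_real_derivative fint_d\<theta> \<theta> r) (at \<theta> within {0..2*pi})"
proof -
  have "\<exists>g. \<forall>\<theta>\<in>{0..2*pi}. (\<lambda>m. fi_coeff d l m \<theta> * r ^ Suc m) sums g \<theta> \<and>
     (g has_real_derivative fint_d\<theta> \<theta> r) (at \<theta> within {0..2*pi})"
  proof (rule has_field_derivative_series)
    show "uniform_limit {0..2*pi} (\<lambda>n \<theta>. \<Sum>m<n. fi_coeff' d l m \<theta> * r ^ Suc m) (\<lambda>\<theta>. fint_d\<theta> \<theta> r) sequentially"
      unfolding fint_d\<theta>_def
    proof (rule Weierstrass_m_test[OF _ summable_bound(2)[of radius]])
      fix m t assume "t \<in> {0..2*pi}"
      then show "norm (fi_coeff' d l m t * r ^ Suc m) \<le> radius * (real (Suc m) * (1/4) ^ m)"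
        using fint_d\<theta>_term_bound[of t r m] assms unfolding real_norm_def by blast
    qed
    show "((\<lambda>\<theta>. fi_coeff d l m \<theta> * r ^ Suc m) has_real_derivative fi_coeff' d l m t * r ^ Suc m) (at t within {0..2*pi})" for m t
      by (intro DERIV_cmult_right has_field_derivative_at_within[OF fi_coeff_has_derivative])
  qed (use assms sums_summable[OF fint_sums[OF assms]] in auto)
  then obtain g where g: "\<And>\<theta>. \<theta> \<in> {0..2*pi} \<Longrightarrow> (\<lambda>m. fi_coeff d l m \<theta> * r ^ Suc m) sums g \<theta>"
    "\<And>\<theta>. \<theta> \<in> {0..2*pi} \<Longrightarrow> (g has_real_derivative fint_d\<theta> \<theta> r) (at \<theta> within {0..2*pi})" by blast
  have "g \<theta> = fint \<theta> r" if "\<theta> \<in> {0..2*pi}" for \<theta>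
    using g(1)[OF that] fint_sums[OF that assms(2)] by (rule sums_unique2)
  then show ?thesis
    using g(2)[OF assms(1)] has_derivative_transform[OF assms(1), of "\<lambda>\<theta>. fint \<theta> r" g]
    by (simp add: has_field_derivative_def)
qed

text \<open>Joint continuity in the form used later: along a curve in the first radius, with the
  second one fixed.\<close>

lemma continuous_on_H_slope:
  assumes "S \<subseteq> {0..2*pi}" "continuous_on S a" "\<And>t. t \<in> S \<Longrightarrow> \<bar>a t\<bar> \<le> radius" "\<bar>b\<bar> \<le> radius"
  shows "continuous_on S (\<lambda>t. fint_slope t (a t) b)"
proof (rule uniform_limit_theorem)
  show "uniform_limit S (\<lambda>n t. \<Sum>m<n. fi_coeff d l m t * (\<Sum>j<Suc m. a t ^ j * b ^ (m - j)))
      (\<lambda>t. fint_slope t (a t) b) sequentially"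
    unfolding fint_slope_def
  proof (rule Weierstrass_m_test[OF _ summable_bound(2)[of 1]])
    fix m t assume "t \<in> S"
    then show "norm (fi_coeff d l m t * (\<Sum>j<Suc m. a t ^ j * b ^ (m - j))) \<le> 1 * (real (Suc m) * (1/4) ^ m)"
      unfolding real_norm_def mult_1 using assms by (intro fint_slope_term_bound) auto
  qed
  have "continuous_on S (fi_coeff d l m)" for m
    using fi_coeff_has_derivative[of d l m] by (meson DERIV_continuous_on has_field_derivative_at_within)
  then show "\<forall>\<^sub>F n in sequentially. continuous_on S (\<lambda>t. \<Sum>m<n. fi_coeff d l m t * (\<Sum>j<Suc m. a t ^ j * b ^ (m - j)))"
    using assms(2) by (intro always_eventually allI continuous_intros) auto
qed simp

section \<open>The partial differential equation for the first integral\<close>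

lemma fint_PDE:
  assumes "\<theta> \<in> {0..2*pi}" "\<bar>r\<bar> \<le> radius"
  shows "fint_d\<theta> \<theta> r = lp d l (r * cos \<theta>) *
    (sin \<theta> * cos \<theta> * fint_d\<theta> \<theta> r + (sin \<theta>)\<^sup>2 * r * fint_slope \<theta> r r)"
proof -
  let ?q = "\<lambda>i m. l i * cos \<theta> ^ i * sin \<theta> * (cos \<theta> * fi_coeff' d l m \<theta> + sin \<theta> * real (m + 1) * fi_coeff d l m \<theta>)"
  let ?Q = "sin \<theta> * cos \<theta> * fint_d\<theta> \<theta> r + (sin \<theta>)\<^sup>2 * r * fint_slope \<theta> r r"
  \<comment> \<open>On the diagonal the divided difference becomes the partial derivative in
    \<open>r\<close>.\<close>
  have "(\<Sum>j<Suc m. r ^ j * r ^ (m - j)) = (\<Sum>j<Suc m. r ^ m)" for m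
    by (rule sum.cong) (auto simp: power_add[symmetric])
  then have slope: "(\<Sum>j<Suc m. r ^ j * r ^ (m - j)) = real (m + 1) * r ^ m" for m
    by (simp del: sum.lessThan_Suc)
  have q: "(\<lambda>m. if i \<le> m then ?q i (m - i) * r ^ Suc m else 0) sums (l i * (r * cos \<theta>) ^ i * ?Q)" for i
  proof -
    have "(\<lambda>m. l i * (r * cos \<theta>) ^ i * (sin \<theta> * cos \<theta> * (fi_coeff' d l m \<theta> * r ^ Suc m) +
        (sin \<theta>)\<^sup>2 * r * (fi_coeff d l m \<theta> * (\<Sum>j<Suc m. r ^ j * r ^ (m - j))))) sums (l i * (r * cos \<theta>) ^ i * ?Q)"
      by (intro sums_mult sums_add fint_d\<theta>_sums fint_slope_sums assms)
    \<comment> \<open>Multiplication by \<open>r ^ i\<close> shifts the index by \<open>i\<close>;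
      the guard supplies the \<open>i\<close> zero terms in front.\<close>
    also have "(\<lambda>m. l i * (r * cos \<theta>) ^ i * (sin \<theta> * cos \<theta> * (fi_coeff' d l m \<theta> * r ^ Suc m) +
        (sin \<theta>)\<^sup>2 * r * (fi_coeff d l m \<theta> * (\<Sum>j<Suc m. r ^ j * r ^ (m - j))))) =
        (\<lambda>m. (\<lambda>m. if i \<le> m then ?q i (m - i) * r ^ Suc m else 0) (m + i))"
      unfolding slope by (simp add: power_mult_distrib power_add power2_eq_square algebra_simps)
    finally show ?thesis by (subst (asm) sums_iff_shift) simp
  qed
  have "(\<lambda>m. \<Sum>i=1..d. if i \<le> m then ?q i (m - i) * r ^ Suc m else 0) sums
      (\<Sum>i=1..d. l i * (r * cos \<theta>) ^ i * ?Q)"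
    by (rule sums_sum) (rule q)
  moreover have "(\<Sum>i=1..d. if i \<le> m then ?q i (m - i) * r ^ Suc m else 0) = fi_coeff' d l m \<theta> * r ^ Suc m" for m
  proof (cases "m = 0")
    case True
    then show ?thesis by (simp add: fi_coeff'_0)
  next
    case False
    then show ?thesis
      unfolding fi_coeff'_recurrence[OF False[unfolded neq0_conv]] sum_distrib_right
      by (intro sum.cong) auto
  qed
  ultimately have "(\<lambda>m. fi_coeff' d l m \<theta> * r ^ Suc m) sums (lp d l (r * cos \<theta>) * ?Q)"
    unfolding lp_def sum_distrib_right by simp
  with fint_d\<theta>_sums[OF assms] show ?thesis by (rule sums_unique2)
qed

text \<open>The partial differential equation solved for the derivative in \<open>\<theta>\<close>:
  \<open>H\<close> is stationary along the polar vector field. The denominator is at most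
  \<open>-3/4\<close>.\<close>

lemma fint_d\<theta>_eq:
  assumes "\<theta> \<in> {0..2*pi}" "\<bar>r\<bar> \<le> radius"
  shows "fint_d\<theta> \<theta> r = - fint_slope \<theta> r r * polarF d l \<theta> r"
proof -
  let ?p = "lp d l (r * cos \<theta>)"
  have "\<bar>r * cos \<theta>\<bar> \<le> radius * 1"
    unfolding abs_mult using assms(2) by (intro mult_mono) auto
  then have p: "\<bar>?p\<bar> \<le> 1/4" by (intro lp_bound) simp
  have "\<bar>sin \<theta> * cos \<theta> * ?p\<bar> \<le> 1 * 1 * (1/4)"
    unfolding abs_mult by (intro mult_mono p) auto
  then have nz: "-1 + sin \<theta> * cos \<theta> * ?p \<noteq> 0" by linarith
  have "fint_d\<theta> \<theta> r * (-1 + sin \<theta> * cos \<theta> * ?p) = - fint_slope \<theta> r r * (r * ?p * (sin \<theta>)\<^sup>2)"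
    using fint_PDE[OF assms] by (simp add: algebra_simps)
  then show ?thesis
    unfolding polarF_def using nz by (simp add: field_simps)
qed

lemma fint_slope_pos: "\<theta> \<in> {0..2*pi} \<Longrightarrow> \<bar>a\<bar> \<le> radius \<Longrightarrow> \<bar>b\<bar> \<le> radius \<Longrightarrow> fint_slope \<theta> a b > 0"
  using fint_slope_bounds(1)[of \<theta> a b] by linarith

lemma fint_zero [simp]: "fint \<theta> 0 = 0"
  by (simp add: fint_def)

lemma fint_initial: "fint 0 r = r"
proof -
  have "(\<lambda>m. fi_coeff d l m 0 * r ^ Suc m) sums (fi_coeff d l 0 0 * r ^ Suc 0)"
    using sums_finite[of "{0}" "\<lambda>m. fi_coeff d l m 0 * r ^ Suc m"] by (simp add: fi_coeff_at_0)
  then show ?thesis unfolding fint_def by (simp add: fi_coeff_0 sums_iff)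
qed

text \<open>The divided difference against \<open>b = 0\<close>. These constants are behind the
  radii \<open>radius / 9\<close> and \<open>radius / 16\<close> below.\<close>

lemma fint_bounds:
  assumes "\<theta> \<in> {0..2*pi}" "\<bar>r\<bar> \<le> radius"
  shows "2/9 * \<bar>r\<bar> \<le> \<bar>fint \<theta> r\<bar>" "\<bar>fint \<theta> r\<bar> \<le> 16/9 * \<bar>r\<bar>"
proof -
  have s: "2/9 \<le> fint_slope \<theta> r 0" "fint_slope \<theta> r 0 \<le> 16/9"
    using fint_slope_bounds[OF assms, of 0] radius_pos by simp_all
  have "\<bar>fint \<theta> r\<bar> = fint_slope \<theta> r 0 * \<bar>r\<bar>"
    using fint_diff[OF assms, of 0] radius_pos s by (simp add: abs_mult)
  then show "2/9 * \<bar>r\<bar> \<le> \<bar>fint \<theta> r\<bar>" "\<bar>fint \<theta> r\<bar> \<le> 16/9 * \<bar>r\<bar>"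
    using s by (simp_all add: mult_right_mono del: times_divide_eq_left)
qed

lemma fint_inj:
  assumes "\<theta> \<in> {0..2*pi}" "\<bar>a\<bar> \<le> radius" "\<bar>b\<bar> \<le> radius" "fint \<theta> a = fint \<theta> b"
  shows "a = b"
  using fint_diff[OF assms(1-3)] fint_slope_pos[OF assms(1-3)] assms(4) by simp

end

section \<open>The return map\<close>

lemma inverse_coeff_eq:
  fixes h P :: "real \<Rightarrow> real"
  assumes "\<delta> > 0" "\<epsilon> > 0"
    and left: "\<And>x. \<bar>x\<bar> < \<delta> \<Longrightarrow> h (P x) = x"
    and right: "\<And>y. \<bar>y\<bar> < \<epsilon> \<Longrightarrow> \<bar>h y\<bar> < \<delta> \<and> P (h y) = y"
  shows "inverse_coeff P k = (deriv ^^ k) h 0 / fact k"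
  unfolding inverse_coeff_def
proof (rule the_equality)
  \<comment> \<open>Every admissible radius yields the same germ. If
    \<open>\<delta>' \<le> \<delta>\<close>, each \<open>y\<close> near \<open>0\<close> is some
    \<open>P x\<close> to which \<open>left\<close> applies; otherwise \<open>h y\<close> lies in
    the larger ball and injectivity there identifies it.\<close>
  have same: "(deriv ^^ k) (inv_into (ball 0 \<delta>') P) 0 = (deriv ^^ k) h 0"
    if inj: "inj_on P (ball 0 \<delta>')" and int: "0 \<in> interior (P ` ball 0 \<delta>')" for \<delta>'
  proof (rule higher_deriv_cong_ev)
    show "\<forall>\<^sub>F y in nhds 0. inv_into (ball 0 \<delta>') P y = h y"
    proof (cases "\<delta>' \<le> \<delta>")
      case True
      have "\<forall>\<^sub>F y in nhds 0. y \<in> interior (P ` ball 0 \<delta>')"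
        using int by (intro eventually_nhds_in_open) auto
      then show ?thesis
      proof eventually_elim
        case (elim y)
        then obtain x where x: "x \<in> ball 0 \<delta>'" "y = P x" using interior_subset by blast
        then have "h y = x" using left True by auto
        then show ?case using x inv_into_f_f[OF inj x(1)] by simp
      qed
    next
      case False
      have "\<forall>\<^sub>F y in nhds 0. y \<in> ball 0 \<epsilon>"
        using assms(2) by (intro eventually_nhds_in_open) auto
      then show ?thesis
      proof eventually_elim
        case (elim y)
        then have y: "\<bar>h y\<bar> < \<delta>" "P (h y) = y" using right by auto
        then have "h y \<in> ball 0 \<delta>'" using False by auto
        from inv_into_f_f[OF inj this] show ?case using y(2) by simp
      qed
    qed
  qed simp
  have "ball 0 \<epsilon> \<subseteq> P ` ball 0 \<delta>"
  proof
    fix y :: real assume "y \<in> ball 0 \<epsilon>"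
    then have y: "\<bar>h y\<bar> < \<delta>" "P (h y) = y" using right by auto
    then have "h y \<in> ball 0 \<delta>" by simp
    then show "y \<in> P ` ball 0 \<delta>" using y(2) by (metis imageI)
  qed
  then have int: "0 \<in> interior (P ` ball 0 \<delta>)"
    using assms(2) by (intro interiorI[of "ball 0 \<epsilon>"]) auto
  have inj: "inj_on P (ball 0 \<delta>)"
    by (rule inj_on_inverseI[of _ h]) (use left in auto)
  show "\<exists>\<delta>>0. inj_on P (ball 0 \<delta>) \<and> 0 \<in> interior (P ` ball 0 \<delta>) \<and>
      (deriv ^^ k) h 0 / fact k = (deriv ^^ k) (inv_into (ball 0 \<delta>) P) 0 / fact k"
    using assms(1) inj int same[OF inj int] by auto
  show "c = (deriv ^^ k) h 0 / fact k"
    if "\<exists>\<delta>>0. inj_on P (ball 0 \<delta>) \<and> 0 \<in> interior (P ` ball 0 \<delta>) \<and>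
      c = (deriv ^^ k) (inv_into (ball 0 \<delta>) P) 0 / fact k" for c
    using that same by auto
qed

text \<open>Differentiation replaces \<open>c\<close> by \<open>diffs c\<close> and keeps
  convergence on the same disc, so the induction is over all \<open>c\<close>.\<close>

lemma higher_deriv_powser:
  fixes c :: "nat \<Rightarrow> real"
  assumes "K > 0" "\<And>z. \<bar>z\<bar> < K \<Longrightarrow> summable (\<lambda>n. c n * z ^ n)"
  shows "(deriv ^^ k) (\<lambda>z. \<Sum>n. c n * z ^ n) 0 = fact k * c k"
  using assms(2)
proof (induction k arbitrary: c)
  case 0
  then show ?case by simp
next
  case (Suc k)
  have "\<forall>\<^sub>F z in nhds 0. z \<in> ball 0 K"
    using assms(1) by (intro eventually_nhds_in_open) auto
  then have "\<forall>\<^sub>F z in nhds 0. deriv (\<lambda>z. \<Sum>n. c n * z ^ n) z = (\<Sum>n. diffs c n * z ^ n)"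
  proof eventually_elim
    case (elim z)
    then show ?case
      using Suc.prems by (intro DERIV_imp_deriv termdiffs_strong'[where K = K]) auto
  qed
  then have "(deriv ^^ Suc k) (\<lambda>z. \<Sum>n. c n * z ^ n) 0 = (deriv ^^ k) (\<lambda>z. \<Sum>n. diffs c n * z ^ n) 0"
    unfolding funpow_Suc_right o_def by (rule higher_deriv_cong_ev) simp
  also have "\<dots> = fact k * diffs c k"
    using Suc.prems by (intro Suc.IH termdiff_converges[where K = K]) auto
  finally show ?case by (simp add: diffs_def)
qed


section \<open>The first integral along solutions of the polar equation\<close>

lemma fint_along_curve:
  assumes S: "S \<subseteq> {0..2*pi}" "t \<in> S" and cont: "continuous_on S r"
    and r: "\<And>t. t \<in> S \<Longrightarrow> \<bar>r t\<bar> \<le> radius d l"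
    and deriv: "(r has_real_derivative D) (at t within S)"
  shows "((\<lambda>t. fint d l t (r t)) has_real_derivative (fint_d\<theta> d l t (r t) + fint_slope d l t (r t) (r t) * D)) (at t within S)"
proof -
  have t: "t \<in> {0..2*pi}" "\<bar>r t\<bar> \<le> radius d l" using S r by auto
  have ev: "\<forall>\<^sub>F y in at t within S. y \<in> S \<and> y \<noteq> t"
    by (auto simp: eventually_at_filter)
  have "((\<lambda>y. (fint d l y (r t) - fint d l t (r t)) / (y - t)) \<longlongrightarrow> fint_d\<theta> d l t (r t)) (at t within S)"
    using DERIV_subset[OF fint_has_derivative[OF t] S(1)] by (simp add: has_field_derivative_iff)
  moreover have "((\<lambda>y. fint_slope d l y (r y) (r t)) \<longlongrightarrow> fint_slope d l t (r t) (r t)) (at t within S)"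
    using continuous_on_H_slope[OF S(1) cont r t(2)] S(2) by (auto simp: continuous_on_def)
  moreover have "((\<lambda>y. (r y - r t) / (y - t)) \<longlongrightarrow> D) (at t within S)"
    using deriv by (simp add: has_field_derivative_iff)
  \<comment> \<open>The increment of \<open>H\<close> along the curve is split at
    \<open>(y, r t)\<close>: first only the angle moves, then only the radius, where the divided
    difference is an exact factor.\<close>
  ultimately have lim: "((\<lambda>y. (fint d l y (r t) - fint d l t (r t)) / (y - t) + fint_slope d l y (r y) (r t) * ((r y - r t) / (y - t)))
      \<longlongrightarrow> fint_d\<theta> d l t (r t) + fint_slope d l t (r t) (r t) * D) (at t within S)"
    by (intro tendsto_intros)
  have "\<forall>\<^sub>F y in at t within S. (fint d l y (r t) - fint d l t (r t)) / (y - t) + fint_slope d l y (r y) (r t) * ((r y - r t) / (y - t))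
      = (fint d l y (r y) - fint d l t (r t)) / (y - t)"
    using ev
  proof eventually_elim
    case (elim y)
    then have "fint d l y (r y) - fint d l y (r t) = fint_slope d l y (r y) (r t) * (r y - r t)"
      using S r by (intro fint_diff t(2)) auto
    then have "fint d l y (r y) = fint d l y (r t) + fint_slope d l y (r y) (r t) * (r y - r t)" by simp
    then show ?case by (simp add: diff_divide_distrib[symmetric] add_divide_distrib[symmetric])
  qed
  from Lim_transform_eventually[OF lim this] show ?thesis
    by (simp add: has_field_derivative_iff)
qed

lemma fint_constant_on_solution:
  assumes "0 \<le> T" "T \<le> 2*pi"
    and sol: "\<And>t. t \<in> {0..T} \<Longrightarrow> (r has_real_derivative polarF d l t (r t)) (at t within {0..T})"
    and r: "\<And>t. t \<in> {0..T} \<Longrightarrow> \<bar>r t\<bar> \<le> radius d l"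
    and t: "t \<in> {0..T}"
  shows "fint d l t (r t) = r 0"
proof -
  have cont: "continuous_on {0..T} r" using sol by (rule DERIV_continuous_on)
  have "((\<lambda>t. fint d l t (r t)) has_real_derivative 0) (at t within {0..T})" if t: "t \<in> {0..T}" for t
    using fint_along_curve[OF _ t cont r sol[OF t]] fint_d\<theta>_eq[of t "r t" d l] assms(2) t r[OF t] by auto
  then obtain c where c: "\<And>t. t \<in> {0..T} \<Longrightarrow> fint d l t (r t) = c"
    using has_field_derivative_zero_constant[of "{0..T}" "\<lambda>t. fint d l t (r t)"] by auto
  from c[of 0] c[OF t] show ?thesis using assms(1) by (simp add: fint_initial)
qed

text \<open>Smallness is derived rather than assumed, because \<open>rsol\<close> ranges over all
  solutions. At a first angle \<open>T\<close> with \<open>\<bar>r T\<bar> = radius\<close>,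
  conservation of \<open>H\<close> would give \<open>2/9 * radius \<le> \<bar>r 0\<bar>\<close>,
  against \<open>\<bar>r 0\<bar> < radius / 9\<close>.\<close>

lemma polar_solution_small:
  assumes init: "\<bar>r 0\<bar> < radius d l / 9"
    and sol: "\<And>t. t \<in> {0..2*pi} \<Longrightarrow> (r has_real_derivative polarF d l t (r t)) (at t within {0..2*pi})"
    and t: "t \<in> {0..2*pi}"
  shows "\<bar>r t\<bar> < radius d l" "fint d l t (r t) = r 0"
proof -
  have cont: "continuous_on {0..2*pi} r" using sol by (rule DERIV_continuous_on)
  have const: "fint d l t (r t) = r 0"
    if T: "0 \<le> T" "T \<le> 2*pi" and r: "\<And>t. t \<in> {0..T} \<Longrightarrow> \<bar>r t\<bar> \<le> radius d l" and t: "t \<in> {0..T}" for T t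
  proof (rule fint_constant_on_solution[OF T _ r t])
    fix t assume "t \<in> {0..T}"
    then show "(r has_real_derivative polarF d l t (r t)) (at t within {0..T})"
      using T by (intro DERIV_subset[OF sol]) auto
  qed auto
  have small: "\<bar>r t\<bar> < radius d l" if t: "t \<in> {0..2*pi}" for t
  proof (rule ccontr)
    assume "\<not> \<bar>r t\<bar> < radius d l"
    define C where "C = {s \<in> {0..t}. radius d l \<le> \<bar>r s\<bar>}"
    have cont': "continuous_on {0..t} (\<lambda>s. \<bar>r s\<bar>)"
      using t by (intro continuous_intros continuous_on_subset[OF cont]) auto
    have "closed C"
      unfolding C_def by (intro continuous_on_closed_Collect_le cont' continuous_on_const closed_atLeastAtMost)
    moreover have "bounded C"
      by (rule bounded_subset[of "{0..t}"]) (auto simp: C_def)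
    ultimately have "compact C" by (simp add: compact_eq_bounded_closed)
    moreover have "t \<in> C" using t \<open>\<not> \<bar>r t\<bar> < radius d l\<close> by (auto simp: C_def)
    ultimately obtain T where T: "T \<in> C" "\<And>s. s \<in> C \<Longrightarrow> T \<le> s"
      using compact_attains_inf[of C] by blast
    have T': "0 \<le> T" "T \<le> 2*pi" "T \<le> t" using T(1) t by (auto simp: C_def)
    have before: "\<bar>r s\<bar> < radius d l" if "0 \<le> s" "s < T" for s
      using that T(2)[of s] T' by (force simp: C_def)
    \<comment> \<open>At \<open>T\<close> only a lower bound for the modulus is known; the
      intermediate value theorem gives equality, so the estimates for \<open>H\<close> still apply
      at \<open>T\<close>.\<close>
    have "\<exists>s\<ge>0. s \<le> T \<and> \<bar>r s\<bar> = radius d l"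
      using T(1) init radius_pos[of d l] continuous_on_subset[OF cont', of "{0..T}"] T'
      by (intro IVT') (auto simp: C_def)
    then obtain s where s: "0 \<le> s" "s \<le> T" "\<bar>r s\<bar> = radius d l" by blast
    then have "s = T" using before[of s] by force
    have "\<bar>r u\<bar> \<le> radius d l" if "u \<in> {0..T}" for u
      using before[of u] s \<open>s = T\<close> that by (cases "u = T") auto
    then have "fint d l T (r T) = r 0" using T' by (intro const[of T]) auto
    then have "2/9 * \<bar>r T\<bar> \<le> \<bar>r 0\<bar>"
      using fint_bounds(1)[of T "r T" d l] s \<open>s = T\<close> T' by auto
    then show False using s \<open>s = T\<close> init radius_pos[of d l] by simp
  qed
  show "\<bar>r t\<bar> < radius d l" using small t .
  show "fint d l t (r t) = r 0"
    using small t by (intro const[of "2*pi"]) (auto simp: less_imp_le)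
qed

section \<open>Existence of small solutions\<close>

lemma fint_attains:
  assumes t: "t \<in> {0..2*pi}" and y: "\<bar>y\<bar> \<le> 2/9 * radius d l"
  shows "\<exists>x. \<bar>x\<bar> \<le> radius d l \<and> fint d l t x = y"
proof -
  let ?R = "radius d l"
  have R: "?R > 0" by (rule radius_pos)
  have "(16/9)-lipschitz_on {-?R..?R} (fint d l t)"
  proof (rule lipschitz_onI)
    fix a b assume "a \<in> {-?R..?R}" "b \<in> {-?R..?R}"
    then have ab: "\<bar>a\<bar> \<le> ?R" "\<bar>b\<bar> \<le> ?R" by auto
    have "\<bar>fint_slope d l t a b\<bar> \<le> 16/9" using fint_slope_bounds[OF t ab] by linarith
    then show "dist (fint d l t a) (fint d l t b) \<le> 16/9 * dist a b"
      unfolding dist_real_def fint_diff[OF t ab] abs_mult by (rule mult_right_mono) simp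
  qed simp
  then have cont: "continuous_on {-?R..?R} (fint d l t)" by (rule lipschitz_on_continuous_on)
  have "fint d l t ?R = fint_slope d l t ?R 0 * ?R" "fint d l t (-?R) = - (fint_slope d l t (-?R) 0 * ?R)"
    using fint_diff[OF t, of ?R d l 0] fint_diff[OF t, of "-?R" d l 0] R by auto
  moreover have "2/9 * ?R \<le> fint_slope d l t ?R 0 * ?R" "2/9 * ?R \<le> fint_slope d l t (-?R) 0 * ?R"
    using R fint_slope_bounds(1)[OF t, of _ d l 0] by (auto intro!: mult_right_mono simp del: times_divide_eq_left)
  ultimately have "fint d l t (-?R) \<le> y" "y \<le> fint d l t ?R" using y by linarith+
  then obtain x where "-?R \<le> x" "x \<le> ?R" "fint d l t x = y"
    using IVT'[of "fint d l t" "-?R" y ?R] cont R by auto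
  then show ?thesis by (auto intro!: exI[of _ x])
qed

text \<open>The implicit function theorem by hand: \<open>r t\<close> is picked on the level
  \<open>r0\<close> of \<open>H\<close>, and the divided difference plays the role of the partial
  derivative in \<open>r\<close>.\<close>

lemma polar_solution_exists:
  assumes r0: "\<bar>r0\<bar> < radius d l / 9"
  shows "\<exists>r. r 0 = r0 \<and> (\<forall>t\<in>{0..2*pi}. (r has_real_derivative polarF d l t (r t)) (at t within {0..2*pi}))"
proof -
  have "\<forall>t\<in>{0..2*pi}. \<exists>x. \<bar>x\<bar> \<le> radius d l \<and> fint d l t x = r0"
    using r0 radius_pos[of d l] by (intro ballI fint_attains) auto
  then obtain r where r: "\<And>t. t \<in> {0..2*pi} \<Longrightarrow> \<bar>r t\<bar> \<le> radius d l" "\<And>t. t \<in> {0..2*pi} \<Longrightarrow> fint d l t (r t) = r0"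
    using bchoice[of "{0..2*pi}" "\<lambda>t x. \<bar>x\<bar> \<le> radius d l \<and> fint d l t x = r0"] by blast
  \<comment> \<open>Both points lie on one level of \<open>H\<close>, so the increment of
    \<open>r\<close> is expressed by a change of \<open>H\<close> in the angle alone.\<close>
  have eq: "r y - r t = - (fint d l y (r t) - fint d l t (r t)) / fint_slope d l y (r y) (r t)"
    if "t \<in> {0..2*pi}" "y \<in> {0..2*pi}" for t y
  proof -
    have "fint_slope d l y (r y) (r t) * (r y - r t) = - (fint d l y (r t) - fint d l t (r t))"
      using fint_diff[OF that(2) r(1)[OF that(2)] r(1)[OF that(1)]] r(2) that by simp
    then show ?thesis
      using fint_slope_pos[OF that(2) r(1)[OF that(2)] r(1)[OF that(1)]] by (simp add: field_simps)
  qed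
  have ev: "\<forall>\<^sub>F y in at t within {0..2*pi}. y \<in> {0..2*pi} \<and> y \<noteq> t" for t
    by (auto simp: eventually_at_filter)
  \<comment> \<open>Continuity comes first: the limit of the divided difference along
    \<open>r\<close> relies on it.\<close>
  have cont: "continuous_on {0..2*pi} r"
    unfolding continuous_on_def
  proof
    fix t assume t: "t \<in> {0..2*pi}"
    have "((\<lambda>y. fint d l y (r t)) \<longlongrightarrow> fint d l t (r t)) (at t within {0..2*pi})"
      using fint_has_derivative[OF t r(1)[OF t]] DERIV_continuous continuous_within by blast
    then have lim: "((\<lambda>y. 9/2 * \<bar>fint d l y (r t) - fint d l t (r t)\<bar>) \<longlongrightarrow> 0) (at t within {0..2*pi})"
      by (auto intro!: tendsto_eq_intros)
    have "\<forall>\<^sub>F y in at t within {0..2*pi}. norm (r y - r t) \<le> 9/2 * \<bar>fint d l y (r t) - fint d l t (r t)\<bar>"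
      using ev
    proof eventually_elim
      case (elim y)
      let ?s = "fint_slope d l y (r y) (r t)" and ?h = "\<bar>fint d l y (r t) - fint d l t (r t)\<bar>"
      have s: "2/9 \<le> ?s" using elim t r by (intro fint_slope_bounds) auto
      have "\<bar>r y - r t\<bar> = ?h / ?s" unfolding eq[OF t conjunct1[OF elim]] using s by (simp add: abs_divide abs_minus_commute)
      also have "\<dots> \<le> ?h / (2/9)" using s by (intro divide_left_mono) auto
      finally show ?case by simp
    qed
    from Lim_null_comparison[OF this lim] show "(r \<longlongrightarrow> r t) (at t within {0..2*pi})"
      by (rule LIM_zero_cancel)
  qed
  have "(r has_real_derivative polarF d l t (r t)) (at t within {0..2*pi})" if t: "t \<in> {0..2*pi}" for t
  proof -
    have s: "fint_slope d l t (r t) (r t) > 0" using t r by (intro fint_slope_pos) auto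
    have "((\<lambda>y. (fint d l y (r t) - fint d l t (r t)) / (y - t)) \<longlongrightarrow> fint_d\<theta> d l t (r t)) (at t within {0..2*pi})"
      using fint_has_derivative[OF t r(1)[OF t]] by (simp add: has_field_derivative_iff)
    moreover have "((\<lambda>y. fint_slope d l y (r y) (r t)) \<longlongrightarrow> fint_slope d l t (r t) (r t)) (at t within {0..2*pi})"
      using continuous_on_H_slope[OF subset_refl cont r(1) r(1)[OF t]] t by (simp add: continuous_on_def)
    ultimately have lim: "((\<lambda>y. - ((fint d l y (r t) - fint d l t (r t)) / (y - t)) / fint_slope d l y (r y) (r t))
        \<longlongrightarrow> - fint_d\<theta> d l t (r t) / fint_slope d l t (r t) (r t)) (at t within {0..2*pi})"
      using s by (intro tendsto_intros) auto
    have "\<forall>\<^sub>F y in at t within {0..2*pi}. - ((fint d l y (r t) - fint d l t (r t)) / (y - t)) / fint_slope d l y (r y) (r t)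
        = (r y - r t) / (y - t)"
      using ev
    proof eventually_elim
      case (elim y)
      show ?case unfolding eq[OF t conjunct1[OF elim]] by (simp add: mult.commute minus_divide_left)
    qed
    from Lim_transform_eventually[OF lim this]
    have "(r has_real_derivative - fint_d\<theta> d l t (r t) / fint_slope d l t (r t) (r t)) (at t within {0..2*pi})"
      by (simp add: has_field_derivative_iff)
    moreover have "- fint_d\<theta> d l t (r t) / fint_slope d l t (r t) (r t) = polarF d l t (r t)"
      using fint_d\<theta>_eq[OF t r(1)[OF t]] s by simp
    ultimately show ?thesis by simp
  qed
  moreover have "r 0 = r0" using r(2)[of 0] by (simp add: fint_initial)
  ultimately show ?thesis by blast
qed

section \<open>The return map and its inverse\<close>

lemma rsol_full_turn:
  assumes r0: "\<bar>r0\<bar> < radius d l / 9"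
  shows "\<bar>rsol d l (2*pi) r0\<bar> < radius d l" "fint d l (2*pi) (rsol d l (2*pi) r0) = r0"
proof -
  obtain r where r: "r 0 = r0" "\<And>t. t\<in>{0..2*pi} \<Longrightarrow> (r has_real_derivative polarF d l t (r t)) (at t within {0..2*pi})"
    using polar_solution_exists[OF assms] by blast
  have b: "\<bar>r (2*pi)\<bar> < radius d l" "fint d l (2*pi) (r (2*pi)) = r0"
    using polar_solution_small[where r = r and t = "2*pi", OF _ r(2)] r(1) r0 by auto
  have "rsol d l (2*pi) r0 = r (2*pi)"
    unfolding rsol_def
  proof (rule the_equality)
    fix y assume "\<exists>r. r 0 = r0 \<and>
      (\<forall>t\<in>{0..2*pi}. (r has_real_derivative polarF d l t (r t)) (at t within {0..2*pi})) \<and> r (2*pi) = y"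
    then obtain q where q: "q 0 = r0" "q (2*pi) = y"
      "\<And>t. t\<in>{0..2*pi} \<Longrightarrow> (q has_real_derivative polarF d l t (q t)) (at t within {0..2*pi})" by blast
    have "\<bar>y\<bar> < radius d l" "fint d l (2*pi) y = r0"
      using polar_solution_small[where r = q and t = "2*pi", OF _ q(3)] q(1,2) r0 by auto
    \<comment> \<open>Two solutions from \<open>r0\<close> end on the same level of \<open>H\<close>
      at angle \<open>2*pi\<close>, where \<open>H\<close> is injective in \<open>r\<close>.\<close>
    then show "y = r (2*pi)"
      using b fint_inj[of "2*pi" y d l "r (2*pi)"] by simp
  qed (use r in blast)
  then show "\<bar>rsol d l (2*pi) r0\<bar> < radius d l" "fint d l (2*pi) (rsol d l (2*pi) r0) = r0"
    using b by simp_all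
qed

lemma fint_higher_deriv: "(deriv ^^ Suc m) (fint d l (2*pi)) 0 / fact (Suc m) = fi_coeff d l m (2*pi)"
proof -
  \<comment> \<open>Index shift: \<open>H\<close> has no constant term, and
    \<open>fi_coeff d l m\<close> belongs to \<open>r ^ (m + 1)\<close>.\<close>
  let ?c = "\<lambda>n. case n of 0 \<Rightarrow> 0 | Suc m \<Rightarrow> fi_coeff d l m (2*pi)"
  let ?R = "radius d l"
  have sums: "(\<lambda>n. ?c n * z ^ n) sums fint d l (2*pi) z" if "\<bar>z\<bar> < ?R" for z
    using fint_sums[of "2*pi" z d l] sums_Suc_iff[of "\<lambda>n. ?c n * z ^ n" "fint d l (2*pi) z"] that by simp
  have "\<forall>\<^sub>F z in nhds 0. z \<in> ball 0 ?R"
    using radius_pos[of d l] by (intro eventually_nhds_in_open) auto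
  then have "\<forall>\<^sub>F z in nhds 0. fint d l (2*pi) z = (\<Sum>n. ?c n * z ^ n)"
    by eventually_elim (use sums in \<open>auto simp: sums_iff\<close>)
  then have "(deriv ^^ Suc m) (fint d l (2*pi)) 0 = (deriv ^^ Suc m) (\<lambda>z. \<Sum>n. ?c n * z ^ n) 0"
    by (rule higher_deriv_cong_ev) simp
  also have "\<dots> = fact (Suc m) * ?c (Suc m)"
    using sums by (intro higher_deriv_powser[OF radius_pos[of d l]]) (auto simp: sums_iff)
  finally show ?thesis by (simp del: fact_Suc funpow.simps)
qed

lemma vcoeff_full_turn: "vcoeff d (Suc m) (2*pi) l = fi_coeff d l m (2*pi)"
  unfolding vcoeff_def fint_higher_deriv[symmetric]
proof (rule inverse_coeff_eq)
  let ?R = "radius d l"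
  \<comment> \<open>Solutions are controlled for initial values below \<open>?R / 9\<close>, and
    \<open>H\<close> enlarges moduli by at most \<open>16/9\<close>, hence \<open>?R / 16\<close>
    for its argument.\<close>
  show "?R / 9 > 0" "?R / 16 > 0" using radius_pos[of d l] by auto
  show "fint d l (2*pi) (rsol d l (2*pi) x) = x" if "\<bar>x\<bar> < ?R / 9" for x
    using rsol_full_turn(2)[OF that] .
  show "\<bar>fint d l (2*pi) y\<bar> < ?R / 9 \<and> rsol d l (2*pi) (fint d l (2*pi) y) = y" if y: "\<bar>y\<bar> < ?R / 16" for y
  proof -
    have y': "\<bar>y\<bar> \<le> ?R" using y by linarith
    have H: "\<bar>fint d l (2*pi) y\<bar> < ?R / 9" using fint_bounds(2)[OF _ y', of "2*pi"] y by simp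
    have "rsol d l (2*pi) (fint d l (2*pi) y) = y"
      using rsol_full_turn[OF H] y' fint_inj[of "2*pi" "rsol d l (2*pi) (fint d l (2*pi) y)" d l y] by simp
    then show ?thesis using H by simp
  qed
qed


section \<open>The Bautin ideals\<close>

lemma gen_ideal_add:
  assumes "f \<in> gen_ideal d G" "g \<in> gen_ideal d G"
  shows "(\<lambda>l. f l + g l) \<in> gen_ideal d G"
  using assms(1)
proof induction
  case zero
  then show ?case using assms(2) by simp
next
  case (step p h f)
  from gen_ideal.step[OF step(1,2,4)] show ?case by (simp add: add.assoc)
qed

lemma gen_ideal_mult:
  assumes "f \<in> gen_ideal d G" "p \<in> polyfun d"
  shows "(\<lambda>l. p l * f l) \<in> gen_ideal d G"
  using assms(1)
proof induction
  case zero
  then show ?case by (simp add: gen_ideal.zero)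
next
  case (step q h f)
  from gen_ideal.step[OF polyfun.mult[OF assms(2) step(1)] step(2,4)] show ?case
    by (simp add: algebra_simps)
qed

lemma gen_ideal_generator: "h \<in> G \<Longrightarrow> h \<in> gen_ideal d G"
  using gen_ideal.step[OF polyfun.const[of 1] _ gen_ideal.zero, of h G d] by simp

lemma gen_ideal_subset:
  assumes "G \<subseteq> gen_ideal d G'"
  shows "gen_ideal d G \<subseteq> gen_ideal d G'"
proof
  fix f assume "f \<in> gen_ideal d G"
  then show "f \<in> gen_ideal d G'"
  proof induction
    case zero
    show ?case by (rule gen_ideal.zero)
  next
    case (step p h f)
    then show ?case using assms by (intro gen_ideal_add gen_ideal_mult) auto
  qed
qed

lemma gen_ideal_sum:
  assumes "finite A" "\<And>x. x \<in> A \<Longrightarrow> (\<lambda>l. f x l) \<in> gen_ideal d G"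
  shows "(\<lambda>l. \<Sum>x\<in>A. f x l) \<in> gen_ideal d G"
  using assms by (induction A) (auto intro: gen_ideal.zero gen_ideal_add)

lemma polyfun_word: "set w \<subseteq> {1..d} \<Longrightarrow> (\<lambda>l. prod_list (map l w)) \<in> polyfun d"
  by (induction w) (auto intro: polyfun.const polyfun.mult[OF polyfun.var])

section \<open>Ideals generated by the first even-indexed parameters\<close>

definition even_ideal :: "nat \<Rightarrow> nat \<Rightarrow> ((nat \<Rightarrow> real) \<Rightarrow> real) set" where
  "even_ideal d m = gen_ideal d {(\<lambda>l. l (2 * i)) | i. 1 \<le> i \<and> i \<le> m}"

lemma word_in_even_ideal:
  assumes "set w \<subseteq> {1..d}" "2 * i \<in> set w" "i \<le> m"
  shows "(\<lambda>l. prod_list (map l w)) \<in> even_ideal d m"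
proof -
  obtain u v where w: "w = u @ 2 * i # v" using assms(2) by (meson split_list)
  have "(\<lambda>l. l (2 * i)) \<in> even_ideal d m"
    unfolding even_ideal_def using assms by (intro gen_ideal_generator) force
  moreover have "(\<lambda>l. prod_list (map l (u @ v))) \<in> polyfun d"
    using assms(1) by (intro polyfun_word) (auto simp: w)
  ultimately have "(\<lambda>l. prod_list (map l (u @ v)) * l (2 * i)) \<in> even_ideal d m"
    unfolding even_ideal_def by (intro gen_ideal_mult)
  then show ?thesis by (simp add: w ac_simps)
qed

lemma even_ideal_vanishes:
  assumes "f \<in> even_ideal d m" "\<And>i. i \<le> m \<Longrightarrow> l (2 * i) = 0"
  shows "f l = 0"
  using assms(1) unfolding even_ideal_def by induction (use assms(2) in auto)

lemma even_letter_of_nonzero_coeff: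
  assumes "w \<in> words d k" "k > 0" "word_coeff w (2 * pi) \<noteq> 0"
  obtains i where "2 * i \<in> set w" "1 \<le> i" "2 * i \<le> d" "2 * i \<le> k"
proof -
  have "w \<noteq> []" using assms by (auto simp: words_def)
  then obtain e where e: "e \<in> set w" "even e"
    using word_coeff_odd_full_turn assms(3) by blast
  then obtain i where i: "e = 2 * i" by auto
  have "e \<le> sum_list w" using e by (intro member_le_sum_list) auto
  then show ?thesis using that[of i] e i assms(1) by (auto simp: words_def)
qed

text \<open>The second hypothesis says that every even letter available in a word of weight
  \<open>k\<close> is at most \<open>2 * m\<close>; each monomial with nonzero coefficient contains
  such a letter.\<close>

lemma vcoeff_in_even_ideal:
  assumes "k > 0" "\<And>i. 2 * i \<le> d \<Longrightarrow> 2 * i \<le> k \<Longrightarrow> i \<le> m"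
  shows "vcoeff d (Suc k) (2 * pi) \<in> even_ideal d m"
proof -
  have "(\<lambda>l. word_coeff w (2 * pi) * prod_list (map l w)) \<in> even_ideal d m" if w: "w \<in> words d k" for w
  proof (cases "word_coeff w (2 * pi) = 0")
    case True
    then show ?thesis by (simp add: even_ideal_def gen_ideal.zero)
  next
    case False
    then obtain i where i: "2 * i \<in> set w" "1 \<le> i" "2 * i \<le> d" "2 * i \<le> k"
      using even_letter_of_nonzero_coeff[OF w assms(1)] by metis
    have "(\<lambda>l. prod_list (map l w)) \<in> even_ideal d m"
      using w i assms(2) by (intro word_in_even_ideal) (auto simp: words_def)
    then show ?thesis unfolding even_ideal_def by (intro gen_ideal_mult polyfun.const)
  qed
  then have "(\<lambda>l. fi_coeff d l k (2 * pi)) \<in> even_ideal d m"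
    unfolding fi_coeff_def even_ideal_def by (intro gen_ideal_sum finite_words)
  moreover have "vcoeff d (Suc k) (2 * pi) = (\<lambda>l. fi_coeff d l k (2 * pi))"
    by (rule ext) (rule vcoeff_full_turn)
  ultimately show ?thesis by simp
qed

text \<open>The letter \<open>k\<close> exhausts the weight, and any further letter would add at
  least \<open>1\<close>.\<close>

lemma singleton_word:
  assumes "w \<in> words d k" "k \<in> set w"
  shows "w = [k]"
proof -
  obtain u v where w: "w = u @ k # v" using assms(2) by (meson split_list)
  have "u = [] \<and> v = []"
    using assms(1) unfolding words_def w by (cases u; cases v) auto
  then show ?thesis using w by simp
qed

text \<open>In weight \<open>2 * j\<close> the letter \<open>2 * j\<close> occurs only in the
  one-letter word; every other word with nonzero coefficient contains a smaller even letter.\<close>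

lemma vcoeff_leading_term:
  assumes "1 \<le> j" "2 * j \<le> d"
  obtains c g where "c > 0" "g \<in> even_ideal d (j - 1)" "vcoeff d (Suc (2 * j)) (2 * pi) = (\<lambda>l. c * l (2 * j) + g l)"
proof
  let ?g = "\<lambda>l. \<Sum>w\<in>words d (2 * j) - {[2 * j]}. word_coeff w (2 * pi) * prod_list (map l w)"
  show "word_coeff [2 * j] (2 * pi) > 0" by (rule word_coeff_even_letter_full_turn) simp
  have "(\<lambda>l. word_coeff w (2 * pi) * prod_list (map l w)) \<in> even_ideal d (j - 1)"
    if w: "w \<in> words d (2 * j)" "w \<noteq> [2 * j]" for w
  proof (cases "word_coeff w (2 * pi) = 0")
    case True
    then show ?thesis by (simp add: even_ideal_def gen_ideal.zero)
  next
    case False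
    then obtain i where i: "2 * i \<in> set w" "1 \<le> i" "2 * i \<le> d" "2 * i \<le> 2 * j"
      using even_letter_of_nonzero_coeff[OF w(1)] assms(1) by (metis mult_pos_pos less_eq_Suc_le One_nat_def pos2)
    have "i \<noteq> j" using singleton_word[OF w(1)] i w(2) by auto
    then have "(\<lambda>l. prod_list (map l w)) \<in> even_ideal d (j - 1)"
      using w i by (intro word_in_even_ideal) (auto simp: words_def)
    then show ?thesis unfolding even_ideal_def by (intro gen_ideal_mult polyfun.const)
  qed
  then show "?g \<in> even_ideal d (j - 1)"
    unfolding even_ideal_def by (intro gen_ideal_sum) (auto simp: finite_words)
  have "[2 * j] \<in> words d (2 * j)" using assms by (auto simp: words_def)
  then show "vcoeff d (Suc (2 * j)) (2 * pi) = (\<lambda>l. word_coeff [2 * j] (2 * pi) * l (2 * j) + ?g l)"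
    by (intro ext) (simp add: vcoeff_full_turn fi_coeff_def sum.remove[OF finite_words] del: word_coeff.simps)
qed

text \<open>The minimum records \<open>2 * i \<le> d\<close> and \<open>2 * i + 1 \<le> k\<close>,
  the latter because the letter \<open>2 * i\<close> needs weight \<open>2 * i\<close>, hence degree
  \<open>2 * i + 1\<close> in \<open>r\<close>. The even parameters are recovered one after another
  by triangular elimination.\<close>

lemma Ik_eq_even_ideal:
  assumes "k \<ge> 2"
  shows "Ik d k = even_ideal d (min (d div 2) ((k - 1) div 2))"
proof
  let ?m = "min (d div 2) ((k - 1) div 2)"
  show "Ik d k \<subseteq> even_ideal d ?m"
    unfolding Ik_def even_ideal_def
  proof (rule gen_ideal_subset, safe)
    fix j assume j: "2 \<le> j" "j \<le> k"
    have "vcoeff d (Suc (j - 1)) (2 * pi) \<in> even_ideal d ?m"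
      using j by (intro vcoeff_in_even_ideal) auto
    then show "vcoeff d j (2 * pi) \<in> gen_ideal d {(\<lambda>l. l (2 * i)) | i. 1 \<le> i \<and> i \<le> ?m}"
      using j by (simp add: even_ideal_def)
  qed
  have "j \<le> ?m \<Longrightarrow> even_ideal d j \<subseteq> Ik d k" for j
  proof (induction j)
    case 0
    then show ?case unfolding Ik_def even_ideal_def by (intro gen_ideal_subset) auto
  next
    case (Suc j)
    let ?v = "vcoeff d (Suc (2 * Suc j)) (2 * pi)"
    obtain c g where c: "c > 0" and g: "g \<in> even_ideal d j" and v: "?v = (\<lambda>l. c * l (2 * Suc j) + g l)"
    proof (rule vcoeff_leading_term[of "Suc j" d])
      show "2 * Suc j \<le> d" using Suc.prems by auto
    qed auto
    have "?v \<in> Ik d k"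
      unfolding Ik_def using Suc.prems by (intro gen_ideal_generator) force
    moreover have "g \<in> Ik d k" using g Suc by auto
    \<comment> \<open>\<open>?v\<close> is solved for its leading variable; the remainder
      \<open>g\<close> is already in the ideal by induction.\<close>
    ultimately have "(\<lambda>l. 1 / c * ?v l + - (1 / c) * g l) \<in> Ik d k"
      unfolding Ik_def by (intro gen_ideal_add gen_ideal_mult polyfun.const)
    also have "(\<lambda>l. 1 / c * ?v l + - (1 / c) * g l) = (\<lambda>l. l (2 * Suc j))"
      unfolding v using c by (simp add: field_simps)
    finally have new: "(\<lambda>l. l (2 * Suc j)) \<in> Ik d k" .
    have "(\<lambda>l. l (2 * i)) \<in> Ik d k" if "1 \<le> i" "i \<le> Suc j" for i
    proof (cases "i = Suc j")
      case True
      then show ?thesis using new by simp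
    next
      case False
      then have "(\<lambda>l. l (2 * i)) \<in> even_ideal d j"
        unfolding even_ideal_def using that by (intro gen_ideal_generator) auto
      then show ?thesis using Suc by auto
    qed
    then show ?case unfolding even_ideal_def Ik_def by (intro gen_ideal_subset) auto
  qed
  then show "even_ideal d ?m \<subseteq> Ik d k" by simp
qed

text \<open>The point whose only nonzero coordinate has index \<open>2 * n\<close> separates the two
  ideals.\<close>

lemma even_ideal_strict:
  assumes "m < n"
  shows "even_ideal d m \<noteq> even_ideal d n"
proof -
  have "(\<lambda>l. l (2 * n)) \<in> even_ideal d n"
    unfolding even_ideal_def using assms by (intro gen_ideal_generator) force
  moreover have "(\<lambda>l. l (2 * n)) \<notin> even_ideal d m"
    using even_ideal_vanishes[of "\<lambda>l. l (2 * n)" d m "\<lambda>i. if i = 2 * n then 1 else 0"] assms by auto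
  ultimately show ?thesis by blast
qed

theorem theorem1p3:
  fixes d n :: nat
  assumes "d \<ge> 2" and "n = d div 2"
  shows "bautin_ideal d = gen_ideal d {(\<lambda>l. l (2 * i)) | i. 1 \<le> i \<and> i \<le> n}
         \<and> bautin_index d = 2 * n + 1"
proof
  have n: "n \<ge> 1" using assms by auto
  have Ik: "Ik d k = even_ideal d (min n ((k - 1) div 2))" if "k \<ge> 2" for k
    using Ik_eq_even_ideal[OF that] assms(2) by simp
  have mono: "even_ideal d i \<subseteq> even_ideal d j" if "i \<le> j" for i j
    unfolding even_ideal_def using that by (intro gen_ideal_subset) (auto intro!: gen_ideal_generator)
  have "bautin_ideal d = even_ideal d n"
  proof
    show "bautin_ideal d \<subseteq> even_ideal d n"
      unfolding bautin_ideal_def by (rule UN_least) (simp add: Ik mono)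
    have "Ik d (2 * n + 1) = even_ideal d n" using n by (simp add: Ik)
    then show "even_ideal d n \<subseteq> bautin_ideal d"
      unfolding bautin_ideal_def using n by (intro SUP_upper2[of "2 * n + 1"]) auto
  qed
  then show "bautin_ideal d = gen_ideal d {(\<lambda>l. l (2 * i)) | i. 1 \<le> i \<and> i \<le> n}"
    by (simp add: even_ideal_def)
  show "bautin_index d = 2 * n + 1"
    unfolding bautin_index_def
  proof (rule Least_equality)
    have "Ik d j = even_ideal d n" if "j \<ge> 2 * n + 1" for j
    proof -
      have "n \<le> (j - 1) div 2" using that by presburger
      then show ?thesis using that n by (simp add: Ik min_def)
    qed
    then show "2 \<le> 2 * n + 1 \<and> (\<forall>j\<ge>2 * n + 1. Ik d j = Ik d (2 * n + 1))" using n by simp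
    fix k assume "2 \<le> k \<and> (\<forall>j\<ge>k. Ik d j = Ik d k)"
    then have k: "2 \<le> k" and stable: "\<And>j. j \<ge> k \<Longrightarrow> Ik d j = Ik d k" by blast+
    show "2 * n + 1 \<le> k"
    proof (rule ccontr)
      assume "\<not> 2 * n + 1 \<le> k"
      then have less: "k \<le> 2 * n + 1" "(k - 1) div 2 < n" using k by presburger+
      \<comment> \<open>Stabilization at such a \<open>k\<close> would identify
        \<open>Ik d k\<close>, generated by fewer than \<open>n\<close> even parameters, with
        \<open>Ik d (2 * n + 1)\<close>.\<close>
      have "even_ideal d n = even_ideal d ((k - 1) div 2)"
        using stable[OF less(1)] less(2) k n by (simp add: Ik min_def)
      then show False using even_ideal_strict[OF less(2)] by blast
    qed
  qed
qed

end
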